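(* Fix an integer $n\geq 1$. Every formula $\phi\in\mathsf{Form}$ that is a tautology (i.e., true in every world of every $n+1$-valued Kripke model) is a theorem of $\mathrm{PDL}_n$. (That is, $\mathrm{PDL}_n$ is complete with respect to the $n+1$-valued Kripke models.)
   Context: Let $\Pi_0$ be a nonempty set of atomic programs and $\mathsf{Prop}$ a countable set of propositional variables. Formulas $\mathsf{Form}$ and programs $\Pi$ are generated by $\phi::=p\mid 0\mid\neg\phi\mid\phi\to\phi\mid[\alpha]\phi$ and $\alpha::=a\mid\phi?\mid\alpha;\alpha\mid\alpha\cup\alpha\mid\alpha^*$ ($p\in\mathsf{Prop}$, $a\in\Pi_0$). Abbreviations: $\phi\vee\psi:=(\phi\to\psi)\to\psi$, $\phi\wedge\psi:=\neg(\neg\phi\vee\neg\psi)$, $\phi\oplus\psi:=\neg\phi\to\psi$, $\phi\odot\psi:=\neg(\neg\phi\oplus\neg\psi)$, $\phi\leftrightarrow\psi:=(\phi\to\psi)\odot(\psi\to\phi)$, $\psi^k:=\psi\odot\cdots\odot\psi$ ($k$ factors, $\psi^0=1:=\neg 0$), $\langle\alpha\rangle\phi:=\neg[\alpha]\neg\phi$. Let $\mathrm{L}_n=\{i/n: 0\le i\le n\}$ with $\neg x=1-x$, $x\to y=\min(1-x+y,1)$ (so $x\oplus y=\min(x+y,1)$, $x\odot y=\max(x+y-1,0)$, $\vee=\max$, $\wedge=\min$). An $n+1$-valued Kripke model $\langle W,R,\mathrm{Val}\rangle$ consists of a nonempty set $W$, a binary relation $R_a\subseteq W\times W$ for each $a\in\Pi_0$,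 and $\mathrm{Val}:W\times\mathsf{Prop}\to\mathrm{L}_n$, extended by mutual induction: $R_{\alpha;\beta}=R_\alpha\circ R_\beta$ (where $R\circ R'=\{(u,w):\exists v\,(uRv\ \&\ vR'w)\}$), $R_{\alpha\cup\beta}=R_\alpha\cup R_\beta$, $R_{\psi?}=\{(u,u):\mathrm{Val}(u,\psi)=1\}$, $R_{\alpha^*}=\bigcup_{k\in\omega}R_\alpha^k$ (reflexive–transitive closure); $\mathrm{Val}(w,0)=0$, $\mathrm{Val}(w,\phi\to\psi)=\mathrm{Val}(w,\phi)\to\mathrm{Val}(w,\psi)$, $\mathrm{Val}(w,\neg\psi)=1-\mathrm{Val}(w,\psi)$, $\mathrm{Val}(w,[\alpha]\psi)=\bigwedge\{\mathrm{Val}(v,\psi):(w,v)\in R_\alpha\}$ (empty infimum $=1$). A formula is true at $w$ if its value is $1$. $\mathrm{PDL}_n$ is the smallest set of formulas closed under modus ponens (from $\phi$ and $\phi\to\psi$ infer $\psi$), uniform substitution of formulas for propositional variables, and necessitation (from $\phi$ infer $[\alpha]\phi$ for any $\alpha\in\Pi$), and containing: (1) all tautologies of $n+1$-valued Łukasiewicz logic (formulas built from variables, $0,\neg,\to$ whose interpretation on $\mathrm{L}_n$ is constantly $1$); (2) for every $\alpha$: $[\alpha](p\to q)\to([\alpha]p\to[\alpha]q)$, $[\alpha](p\oplus p)\leftrightarrow([\alpha]p\oplus[\alpha]p)$, $[\alpha](p\odot p)\leftrightarrow([\alpha]p\odot[\alpha]p)$; (3) for all $\alpha,\beta$: $[\alpha\cup\beta]p\leftrightarrow([\alpha]p\wedge[\beta]p)$,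 $[\alpha;\beta]p\leftrightarrow[\alpha][\beta]p$, $[q?]p\leftrightarrow(\neg q^n\vee p)$, $[\alpha^*]p\leftrightarrow(p\wedge[\alpha][\alpha^*]p)$, $[\alpha^*]p\to[\alpha^*][\alpha^*]p$; (4) for every $\alpha$: $(p\wedge[\alpha^*](p\to[\alpha]p)^n)\to[\alpha^*]p$. Here $p,q$ are propositional variables. *)

theory Defs
  imports Complex_Main "HOL-Library.Countable"
begin

section \<open>Syntax\<close>

datatype ('a, 'p) form =
    Var 'p
  | Zero
  | Neg "('a, 'p) form"
  | Imp "('a, 'p) form" "('a, 'p) form"
  | Box "('a, 'p) prog" "('a, 'p) form"
and ('a, 'p) prog =
    Atom 'a
  | Test "('a, 'p) form"
  | Seq "('a, 'p) prog" "('a, 'p) prog"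
  | Choice "('a, 'p) prog" "('a, 'p) prog"
  | Star "('a, 'p) prog"

abbreviation One :: "('a, 'p) form" where
  "One \<equiv> Neg Zero"

abbreviation Or :: "('a, 'p) form \<Rightarrow> ('a, 'p) form \<Rightarrow> ('a, 'p) form" where
  "Or \<phi> \<psi> \<equiv> Imp (Imp \<phi> \<psi>) \<psi>"

abbreviation And :: "('a, 'p) form \<Rightarrow> ('a, 'p) form \<Rightarrow> ('a, 'p) form" where
  "And \<phi> \<psi> \<equiv> Neg (Or (Neg \<phi>) (Neg \<psi>))"

abbreviation Oplus :: "('a, 'p) form \<Rightarrow> ('a, 'p) form \<Rightarrow> ('a, 'p) form" where
  "Oplus \<phi> \<psi> \<equiv> Imp (Neg \<phi>) \<psi>"

abbreviation Odot :: "('a, 'p) form \<Rightarrow> ('a, 'p) form \<Rightarrow> ('a, 'p) form" where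
  "Odot \<phi> \<psi> \<equiv> Neg (Oplus (Neg \<phi>) (Neg \<psi>))"

abbreviation Equ :: "('a, 'p) form \<Rightarrow> ('a, 'p) form \<Rightarrow> ('a, 'p) form" where
  "Equ \<phi> \<psi> \<equiv> Odot (Imp \<phi> \<psi>) (Imp \<psi> \<phi>)"

fun Pow :: "('a, 'p) form \<Rightarrow> nat \<Rightarrow> ('a, 'p) form" where
  "Pow \<psi> 0 = One"
| "Pow \<psi> (Suc 0) = \<psi>"
| "Pow \<psi> (Suc (Suc k)) = Odot \<psi> (Pow \<psi> (Suc k))"

text \<open>Substitution also acts on the formulas tested inside programs.\<close>

primrec subst_form :: "('p \<Rightarrow> ('a, 'p) form) \<Rightarrow> ('a, 'p) form \<Rightarrow> ('a, 'p) form"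
  and subst_prog :: "('p \<Rightarrow> ('a, 'p) form) \<Rightarrow> ('a, 'p) prog \<Rightarrow> ('a, 'p) prog"
where
  "subst_form \<sigma> (Var p) = \<sigma> p"
| "subst_form \<sigma> Zero = Zero"
| "subst_form \<sigma> (Neg \<phi>) = Neg (subst_form \<sigma> \<phi>)"
| "subst_form \<sigma> (Imp \<phi> \<psi>) = Imp (subst_form \<sigma> \<phi>) (subst_form \<sigma> \<psi>)"
| "subst_form \<sigma> (Box \<alpha> \<phi>) = Box (subst_prog \<sigma> \<alpha>) (subst_form \<sigma> \<phi>)"
| "subst_prog \<sigma> (Atom a) = Atom a"
| "subst_prog \<sigma> (Test \<phi>) = Test (subst_form \<sigma> \<phi>)"
| "subst_prog \<sigma> (Seq \<alpha> \<beta>) = Seq (subst_prog \<sigma> \<alpha>) (subst_prog \<sigma> \<beta>)"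
| "subst_prog \<sigma> (Choice \<alpha> \<beta>) = Choice (subst_prog \<sigma> \<alpha>) (subst_prog \<sigma> \<beta>)"
| "subst_prog \<sigma> (Star \<alpha>) = Star (subst_prog \<sigma> \<alpha>)"


section \<open>Finitely-valued Lukasiewicz logic\<close>

definition luk_set :: "nat \<Rightarrow> real set" where
  "luk_set n = {real i / real n | i. i \<le> n}"

definition luk_neg :: "real \<Rightarrow> real" where
  "luk_neg x = 1 - x"

definition luk_imp :: "real \<Rightarrow> real \<Rightarrow> real" where
  "luk_imp x y = min (1 - x + y) 1"

primrec box_free :: "('a, 'p) form \<Rightarrow> bool" where
  "box_free (Var p) = True"
| "box_free Zero = True"
| "box_free (Neg \<phi>) = box_free \<phi>"
| "box_free (Imp \<phi> \<psi>) = (box_free \<phi> \<and> box_free \<psi>)"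
| "box_free (Box \<alpha> \<phi>) = False"

text \<open>Only used on box-free formulas; the value on boxes is a dummy.\<close>

primrec luk_val :: "('p \<Rightarrow> real) \<Rightarrow> ('a, 'p) form \<Rightarrow> real" where
  "luk_val v (Var p) = v p"
| "luk_val v Zero = 0"
| "luk_val v (Neg \<phi>) = luk_neg (luk_val v \<phi>)"
| "luk_val v (Imp \<phi> \<psi>) = luk_imp (luk_val v \<phi>) (luk_val v \<psi>)"
| "luk_val v (Box \<alpha> \<phi>) = undefined"

definition luk_tautology :: "nat \<Rightarrow> ('a, 'p) form \<Rightarrow> bool" where
  "luk_tautology n \<phi> \<longleftrightarrow>
     box_free \<phi> \<and> (\<forall>v. (\<forall>p. v p \<in> luk_set n) \<longrightarrow> luk_val v \<phi> = 1)"


section \<open>Many-valued Kripke models\<close>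

record ('w, 'a, 'p) kripke =
  worlds :: "'w set"
  acc :: "'a \<Rightarrow> ('w \<times> 'w) set"
  valu :: "'w \<Rightarrow> 'p \<Rightarrow> real"

definition kripke_model :: "nat \<Rightarrow> ('w, 'a, 'p) kripke \<Rightarrow> bool" where
  "kripke_model n M \<longleftrightarrow>
     worlds M \<noteq> {} \<and>
     (\<forall>a. acc M a \<subseteq> worlds M \<times> worlds M) \<and>
     (\<forall>w\<in>worlds M. \<forall>p. valu M w p \<in> luk_set n)"

text \<open>
  The infimum over the empty set is the top element 1, which has to be said explicitly because
  \<open>Inf\<close> on the reals leaves it unspecified. The relation of an iterated program is reflexive
  on the set of worlds only, hence the intersection.
\<close>

primrec val :: "('w, 'a, 'p) kripke \<Rightarrow> ('a, 'p) form \<Rightarrow> 'w \<Rightarrow> real"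
  and rel :: "('w, 'a, 'p) kripke \<Rightarrow> ('a, 'p) prog \<Rightarrow> ('w \<times> 'w) set"
where
  "val M (Var p) = (\<lambda>w. valu M w p)"
| "val M Zero = (\<lambda>w. 0)"
| "val M (Neg \<phi>) = (\<lambda>w. luk_neg (val M \<phi> w))"
| "val M (Imp \<phi> \<psi>) = (\<lambda>w. luk_imp (val M \<phi> w) (val M \<psi> w))"
| "val M (Box \<alpha> \<phi>) = (\<lambda>w.
     if \<exists>v. (w, v) \<in> rel M \<alpha> then Inf {val M \<phi> v | v. (w, v) \<in> rel M \<alpha>} else 1)"
| "rel M (Atom a) = acc M a"
| "rel M (Test \<psi>) = {(u, u) | u. u \<in> worlds M \<and> val M \<psi> u = 1}"
| "rel M (Seq \<alpha> \<beta>) = rel M \<alpha> O rel M \<beta>"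
| "rel M (Choice \<alpha> \<beta>) = rel M \<alpha> \<union> rel M \<beta>"
| "rel M (Star \<alpha>) = (rel M \<alpha>)\<^sup>* \<inter> (worlds M \<times> worlds M)"

definition true_at :: "('w, 'a, 'p) kripke \<Rightarrow> 'w \<Rightarrow> ('a, 'p) form \<Rightarrow> bool" where
  "true_at M w \<phi> \<longleftrightarrow> val M \<phi> w = 1"


section \<open>The logic\<close>

inductive_set PDL :: "nat \<Rightarrow> ('a, 'p) form set" for n :: nat where
  luk: "luk_tautology n \<phi> \<Longrightarrow> \<phi> \<in> PDL n"
| box_imp: "Imp (Box \<alpha> (Imp (Var p) (Var q)))
     (Imp (Box \<alpha> (Var p)) (Box \<alpha> (Var q))) \<in> PDL n"
| box_oplus: "Equ (Box \<alpha> (Oplus (Var p) (Var p)))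
     (Oplus (Box \<alpha> (Var p)) (Box \<alpha> (Var p))) \<in> PDL n"
| box_odot: "Equ (Box \<alpha> (Odot (Var p) (Var p)))
     (Odot (Box \<alpha> (Var p)) (Box \<alpha> (Var p))) \<in> PDL n"
| choice: "Equ (Box (Choice \<alpha> \<beta>) (Var p))
     (And (Box \<alpha> (Var p)) (Box \<beta> (Var p))) \<in> PDL n"
| seq: "Equ (Box (Seq \<alpha> \<beta>) (Var p)) (Box \<alpha> (Box \<beta> (Var p))) \<in> PDL n"
| test: "Equ (Box (Test (Var q)) (Var p)) (Or (Neg (Pow (Var q) n)) (Var p)) \<in> PDL n"
| star_unfold: "Equ (Box (Star \<alpha>) (Var p))
     (And (Var p) (Box \<alpha> (Box (Star \<alpha>) (Var p)))) \<in> PDL n"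
| star_trans: "Imp (Box (Star \<alpha>) (Var p)) (Box (Star \<alpha>) (Box (Star \<alpha>) (Var p))) \<in> PDL n"
| star_induct: "Imp (And (Var p) (Box (Star \<alpha>) (Pow (Imp (Var p) (Box \<alpha> (Var p))) n)))
     (Box (Star \<alpha>) (Var p)) \<in> PDL n"
| mp: "\<phi> \<in> PDL n \<Longrightarrow> Imp \<phi> \<psi> \<in> PDL n \<Longrightarrow> \<psi> \<in> PDL n"
| subst: "\<phi> \<in> PDL n \<Longrightarrow> subst_form \<sigma> \<phi> \<in> PDL n"
| nec: "\<phi> \<in> PDL n \<Longrightarrow> Box \<alpha> \<phi> \<in> PDL n"

end

theory Submission
  imports Defs "HOL-Analysis.Function_Topology"
begin

text \<open>
  Canonical worlds are the homomorphisms from formulas to the Lukasiewicz chain that send every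
  theorem to 1. Substitution instances of tautologies together with compactness of the space of
  homomorphisms separate any theory from a formula outside of it. Iterating \<open>x \<mapsto> x \<oplus> x\<close> and
  \<open>x \<mapsto> x \<odot> x\<close> yields all threshold functions on the chain, and boxes commute with both maps, so
  that the value of a boxed formula, and not only its truth, is the minimum over the canonical
  successors.

  The canonical model may fail \<open>R\<^bsub>\<alpha>*\<^esub> = R\<^bsub>\<alpha>\<^esub>\<^sup>*\<close>, hence it is collapsed along the finite
  Fischer-Ladner closure of the given formula. Every set of collapsed worlds is defined by a
  two-valued formula; applying the induction axiom to the formula defining the worlds reachable
  by \<open>\<alpha>*\<close> shows that canonical \<open>\<alpha>*\<close>-successors are reachable in the collapsed model.
\<close>

section \<open>Thresholds\<close>

fun iter_double :: "bool list \<Rightarrow> ('a, 'p) form \<Rightarrow> ('a, 'p) form" where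
  "iter_double [] \<psi> = \<psi>"
| "iter_double (b # bs) \<psi> =
     (let \<chi> = iter_double bs \<psi> in if b then Odot \<chi> \<chi> else Oplus \<chi> \<chi>)"

definition clip :: "real \<Rightarrow> real" where
  "clip x = min 1 (max 0 x)"

text \<open>On [0,1] the maps \<open>x \<oplus> x\<close> and \<open>x \<odot> x\<close> are
  \<open>clip (2 * x - b)\<close> for b = 0 and b = 1, so a boolean list acts as a list of binary
  digits.\<close>

fun real_iter_double :: "bool list \<Rightarrow> real \<Rightarrow> real" where
  "real_iter_double [] x = x"
| "real_iter_double (b # bs) x = clip (2 * real_iter_double bs x - of_bool b)"

text \<open>The list consists of the \<open>m\<close> binary digits of \<open>c\<close>, the least
  significant one at the head because the head acts last.\<close>

lemma real_iter_double_affine: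
  assumes "c < 2 ^ m"
  shows "\<exists>bs. \<forall>x. 0 \<le> x \<longrightarrow> x \<le> 1 \<longrightarrow> real_iter_double bs x = clip (2 ^ m * x - real c)"
  using assms
proof (induction m arbitrary: c)
  case 0
  then have "\<forall>x. 0 \<le> x \<longrightarrow> x \<le> 1 \<longrightarrow> real_iter_double [] x = clip (2 ^ 0 * x - real c)"
    by (simp add: clip_def)
  then show ?case by blast
next
  case (Suc m)
  then have "c div 2 < 2 ^ m" by (simp add: less_mult_imp_div_less)
  then obtain bs where bs:
    "\<And>x. 0 \<le> x \<Longrightarrow> x \<le> 1 \<Longrightarrow> real_iter_double bs x = clip (2 ^ m * x - real (c div 2))"
    using Suc.IH by blast
  have c: "real c = 2 * real (c div 2) + of_bool (odd c)"
    by (cases "even c") (auto elim!: evenE oddE)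
  \<comment> \<open>Clipping in between does no harm: a value above 1 or below 0 stays on its side
    after doubling and subtracting a digit.\<close>
  have step: "clip (2 * clip y - of_bool b) = clip (2 * y - of_bool b)" for y b
    by (auto simp: clip_def)
  have "real_iter_double (odd c # bs) x = clip (2 ^ Suc m * x - real c)" if "0 \<le> x" "x \<le> 1" for x
    using bs[OF that] c by (simp add: step) (simp add: algebra_simps)
  then show ?case by blast
qed

text \<open>The clipped line \<open>2 ^ m * x - c\<close> rises from 0 to 1 on an interval of length
  \<open>1 / 2 ^ m\<close>, which fits between \<open>s\<close> and \<open>t\<close> once
  \<open>m\<close> is large.\<close>

lemma threshold:
  assumes "0 \<le> s" "s < t" "t \<le> 1"
  obtains bs where
    "\<And>x. 0 \<le> x \<Longrightarrow> x \<le> s \<Longrightarrow> real_iter_double bs x = 0"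
    "\<And>x. t \<le> x \<Longrightarrow> x \<le> 1 \<Longrightarrow> real_iter_double bs x = 1"
proof -
  obtain m where m: "2 / (t - s) < 2 ^ m"
    using real_arch_pow[of 2 "2 / (t - s)"] by auto
  \<comment> \<open>One unit of the gap pays for rounding \<open>c\<close> up, the other for the
    rise from 0 to 1. The same gap keeps \<open>c\<close> below \<open>2 ^ m\<close>.\<close>
  then have gap: "2 < 2 ^ m * t - 2 ^ m * s"
    using assms by (simp add: field_simps)
  define c where "c = nat \<lceil>2 ^ m * s\<rceil>"
  have c: "2 ^ m * s \<le> real c" "real c < 2 ^ m * s + 1"
    using assms unfolding c_def by (auto simp: of_nat_nat) linarith+
  have "2 ^ m * t \<le> 2 ^ m * 1"
    using assms by (intro mult_left_mono) auto
  then have "real c < 2 ^ m"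
    using gap c by linarith
  then have "c < 2 ^ m"
    by simp
  then obtain bs where bs:
    "\<And>x. 0 \<le> x \<Longrightarrow> x \<le> 1 \<Longrightarrow> real_iter_double bs x = clip (2 ^ m * x - real c)"
    using real_iter_double_affine by blast
  show thesis
  proof
    fix x assume "0 \<le> x" "x \<le> s"
    moreover from this have "2 ^ m * x \<le> 2 ^ m * s" by simp
    then have "2 ^ m * x - real c \<le> 0" using c by linarith
    ultimately show "real_iter_double bs x = 0"
      using bs[of x] assms by (simp add: clip_def)
  next
    fix x assume "t \<le> x" "x \<le> 1"
    moreover from this have "2 ^ m * t \<le> 2 ^ m * x" by simp
    then have "1 \<le> 2 ^ m * x - real c" using c gap by linarith
    ultimately show "real_iter_double bs x = 1"
      using bs[of x] assms by (simp add: clip_def)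
  qed
qed

section \<open>Homomorphisms into the Lukasiewicz chain\<close>

lemma luk_set_bounds: "x \<in> luk_set n \<Longrightarrow> 0 \<le> x \<and> x \<le> 1"
  by (auto simp: luk_set_def divide_le_eq_1)

lemma luk_setI: "i \<le> n \<Longrightarrow> real i / real n \<in> luk_set n"
  by (auto simp: luk_set_def)

lemma luk_set_zero: "0 \<in> luk_set n"
  using luk_setI[of 0 n] by simp

lemma luk_set_one: "n \<ge> 1 \<Longrightarrow> 1 \<in> luk_set n"
  using luk_setI[of n n] by simp

lemma finite_luk_set: "finite (luk_set n)"
proof -
  have "luk_set n = (\<lambda>i. real i / real n) ` {..n}"
    by (auto simp: luk_set_def)
  then show ?thesis by simp
qed

text \<open>Discreteness of the chain: strict inequalities gain a margin, which thresholds require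
  and which turns "different from 1" into a closed condition.\<close>

lemma luk_set_gap:
  assumes "x \<in> luk_set n" "y \<in> luk_set n" "x < y"
  shows "x + 1 / n \<le> y"
proof -
  from assms obtain i j where ij: "x = real i / n" "y = real j / n"
    by (auto simp: luk_set_def)
  with assms have "real i < real j" by (simp add: divide_less_cancel split: if_splits)
  then have "(real i + 1) / n \<le> real j / n"
    by (intro divide_right_mono) auto
  then show ?thesis using ij by (simp add: add_divide_distrib)
qed

lemma luk_neg_in_luk_set: "n \<ge> 1 \<Longrightarrow> x \<in> luk_set n \<Longrightarrow> luk_neg x \<in> luk_set n"
proof -
  assume "n \<ge> 1" "x \<in> luk_set n"
  then obtain i where i: "i \<le> n" "x = real i / n" by (auto simp: luk_set_def)
  have "luk_neg x = real (n - i) / n"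
    using i \<open>n \<ge> 1\<close> by (simp add: luk_neg_def of_nat_diff field_simps)
  then show ?thesis by (simp add: luk_setI)
qed

lemma luk_imp_in_luk_set:
  assumes "n \<ge> 1" "x \<in> luk_set n" "y \<in> luk_set n"
  shows "luk_imp x y \<in> luk_set n"
proof -
  obtain i j where ij: "i \<le> n" "x = real i / n" "j \<le> n" "y = real j / n"
    using assms by (auto simp: luk_set_def)
  show ?thesis
  proof (cases "i \<le> j")
    case True
    then have "x \<le> y" using ij by (simp add: divide_right_mono)
    then have "luk_imp x y = real n / real n"
      using assms(1) by (simp add: luk_imp_def)
    then show ?thesis by (metis luk_setI order_refl)
  next
    case False
    then have "y \<le> x" using ij by (simp add: divide_right_mono)
    then have "luk_imp x y = 1 - x + y" by (simp add: luk_imp_def)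
    also have "\<dots> = real (n - i + j) / real n"
      using ij assms(1) by (simp add: of_nat_diff field_simps)
    finally show ?thesis using False luk_setI[of "n - i + j" n] ij by simp
  qed
qed

text \<open>Boxed formulas are constrained only in their range, so they behave like further
  variables; the modal axioms enter with \<open>canonical\<close>.\<close>

definition luk_hom :: "nat \<Rightarrow> (('a, 'p) form \<Rightarrow> real) \<Rightarrow> bool" where
  "luk_hom n u \<longleftrightarrow> (\<forall>\<psi>. u \<psi> \<in> luk_set n) \<and> u Zero = 0 \<and>
     (\<forall>\<psi>. u (Neg \<psi>) = luk_neg (u \<psi>)) \<and> (\<forall>\<psi> \<chi>. u (Imp \<psi> \<chi>) = luk_imp (u \<psi>) (u \<chi>))"

context
  fixes n :: nat and u :: "('a, 'p) form \<Rightarrow> real"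
  assumes hom: "luk_hom n u"
begin

lemma luk_hom_in_luk_set: "u \<psi> \<in> luk_set n"
  using hom by (simp add: luk_hom_def)

lemma luk_hom_nonneg: "0 \<le> u \<psi>"
  and luk_hom_le_one: "u \<psi> \<le> 1"
  using luk_set_bounds[OF luk_hom_in_luk_set] by auto

lemma luk_hom_Zero: "u Zero = 0"
  and luk_hom_Neg: "u (Neg \<psi>) = 1 - u \<psi>"
  and luk_hom_Imp: "u (Imp \<psi> \<chi>) = min (1 - u \<psi> + u \<chi>) 1"
  using hom by (simp_all add: luk_hom_def luk_neg_def luk_imp_def)

lemma luk_hom_One: "u One = 1"
  by (simp add: luk_hom_Neg luk_hom_Zero)

lemma luk_hom_Or: "u (Or \<psi> \<chi>) = max (u \<psi>) (u \<chi>)"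
  using luk_hom_le_one[of \<psi>] luk_hom_le_one[of \<chi>] by (auto simp: luk_hom_Imp)

lemma luk_hom_And: "u (And \<psi> \<chi>) = min (u \<psi>) (u \<chi>)"
  by (simp only: luk_hom_Neg luk_hom_Or)

lemma luk_hom_Oplus: "u (Oplus \<psi> \<chi>) = min (u \<psi> + u \<chi>) 1"
  by (simp add: luk_hom_Neg luk_hom_Imp)

lemma luk_hom_Odot: "u (Odot \<psi> \<chi>) = max (u \<psi> + u \<chi> - 1) 0"
  by (auto simp add: luk_hom_Neg luk_hom_Imp)

lemma luk_hom_Equ: "u (Equ \<psi> \<chi>) = 1 \<longleftrightarrow> u \<psi> = u \<chi>"
  by (auto simp add: luk_hom_Neg luk_hom_Imp)

lemma luk_hom_Pow: "u (Pow \<psi> k) = max 0 (1 - real k * (1 - u \<psi>))"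
proof (induction \<psi> k rule: Pow.induct)
  case (3 \<psi> k)
  have "0 \<le> real k * (1 - u \<psi>)"
    using luk_hom_le_one[of \<psi>] by simp
  then show ?case
    using luk_hom_le_one[of \<psi>] luk_hom_nonneg[of \<psi>] unfolding Pow.simps luk_hom_Odot 3
    by (simp add: algebra_simps)
qed (use luk_hom_nonneg in \<open>simp_all add: luk_hom_Neg luk_hom_Zero\<close>)

text \<open>A value below 1 misses it by at least \<open>1 / n\<close>, and \<open>n\<close> such
  losses exhaust the chain. Hence the n-th power is a two-valued test for value 1, which is how it
  acts in the axioms for tests and iteration.\<close>

lemma luk_hom_Pow_n:
  assumes "n \<ge> 1"
  shows "u (Pow \<psi> n) = (if u \<psi> = 1 then 1 else 0)"
proof (cases "u \<psi> = 1")
  case False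
  have "u \<psi> + 1 / n \<le> 1"
    using luk_set_gap luk_hom_in_luk_set luk_hom_le_one luk_set_one[OF assms] False by (metis less_eq_real_def)
  then have "real n * (1 - u \<psi>) \<ge> 1"
    using assms by (simp add: field_simps)
  then show ?thesis using False by (simp add: luk_hom_Pow)
qed (simp add: luk_hom_Pow)

text \<open>With \<open>k = n\<close> the value is 1 whenever \<open>u \<psi>\<close> is below 1;
  this is the semantic side of the deduction theorem.\<close>

lemma luk_hom_iter_Imp: "u ((Imp \<psi> ^^ k) \<chi>) = min 1 (real k * (1 - u \<psi>) + u \<chi>)"
proof (induction k)
  case (Suc k)
  show ?case
    using mult_left_mono[OF luk_hom_le_one[of \<psi>], of "real k"] luk_hom_le_one[of \<psi>]
    unfolding funpow.simps o_apply luk_hom_Imp Suc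
    by (simp add: algebra_simps)
qed (use luk_hom_le_one in simp)

lemma luk_hom_iter_double: "u (iter_double bs \<psi>) = real_iter_double bs (u \<psi>)"
proof (induction bs)
  case (Cons b bs)
  show ?case
    using luk_hom_nonneg[of "iter_double bs \<psi>"] luk_hom_le_one[of "iter_double bs \<psi>"]
    by (simp add: Let_def luk_hom_Oplus luk_hom_Odot flip: Cons)
       (auto simp: clip_def luk_hom_Imp luk_hom_Neg)
qed simp

end

section \<open>Instances of the axioms\<close>

lemma finite_vars: "finite (set2_form \<phi>)" "finite (set2_prog \<alpha>)"
  for \<phi> :: "('a, 'p) form" and \<alpha> :: "('a, 'p) prog"
  by (induction \<phi> and \<alpha>) auto

lemma subst_id:
  fixes \<phi> :: "('a, 'p) form" and \<alpha> :: "('a, 'p) prog"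
  shows "(\<And>p. p \<in> set2_form \<phi> \<Longrightarrow> \<sigma> p = Var p) \<Longrightarrow> subst_form \<sigma> \<phi> = \<phi>"
    and "(\<And>p. p \<in> set2_prog \<alpha> \<Longrightarrow> \<sigma> p = Var p) \<Longrightarrow> subst_prog \<sigma> \<alpha> = \<alpha>"
  by (induction \<phi> and \<alpha>) auto

lemma subst_Pow: "subst_form \<sigma> (Pow \<psi> k) = Pow (subst_form \<sigma> \<psi>) k"
  by (induction \<psi> k rule: Pow.induct) auto

text \<open>Substitution also changes tests inside programs. A variable fresh for
  \<open>\<alpha>\<close> and \<open>\<beta>\<close> can be replaced without touching them, and
  infinitely many variables guarantee one.\<close>

lemma PDL_instance1:
  fixes \<alpha> \<beta> :: "('a, 'p) prog"
  assumes "infinite (UNIV :: 'p set)" "\<And>p. A (Var p) \<in> PDL n"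
    and "\<And>\<sigma> p. subst_prog \<sigma> \<alpha> = \<alpha> \<Longrightarrow> subst_prog \<sigma> \<beta> = \<beta> \<Longrightarrow>
      subst_form \<sigma> (A (Var p)) = A (\<sigma> p)"
  shows "A \<psi> \<in> PDL n"
proof -
  obtain p where p: "p \<notin> set2_prog \<alpha> \<union> set2_prog \<beta>"
    using ex_new_if_finite[OF assms(1)] finite_vars(2) by (metis finite_UnI)
  define \<sigma> where "\<sigma> = Var(p := \<psi>)"
  have "subst_prog \<sigma> \<alpha> = \<alpha>" "subst_prog \<sigma> \<beta> = \<beta>"
    using p by (auto intro!: subst_id simp: \<sigma>_def)
  then show ?thesis
    using PDL.subst[OF assms(2), of \<sigma> p] assms(3)[of \<sigma> p] by (simp add: \<sigma>_def)
qed

lemma PDL_instance2: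
  fixes \<alpha> :: "('a, 'p) prog"
  assumes "infinite (UNIV :: 'p set)" "\<And>p q. A (Var p) (Var q) \<in> PDL n"
    and "\<And>\<sigma> p q. subst_prog \<sigma> \<alpha> = \<alpha> \<Longrightarrow>
      subst_form \<sigma> (A (Var p) (Var q)) = A (\<sigma> p) (\<sigma> q)"
  shows "A \<psi> \<chi> \<in> PDL n"
proof -
  obtain p where p: "p \<notin> set2_prog \<alpha>"
    using ex_new_if_finite[OF assms(1)] finite_vars(2) by metis
  \<comment> \<open>Distinctness from \<open>p\<close> keeps the two updates in
    \<open>\<sigma>\<close> from overwriting each other.\<close>
  obtain q where q: "q \<notin> insert p (set2_prog \<alpha>)"
    using ex_new_if_finite[OF assms(1)] finite_vars(2) by (metis finite_insert)
  define \<sigma> where "\<sigma> = Var(p := \<psi>, q := \<chi>)"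
  have "subst_prog \<sigma> \<alpha> = \<alpha>"
    using p q by (auto intro!: subst_id simp: \<sigma>_def)
  moreover have "p \<noteq> q"
    using q by auto
  ultimately show ?thesis
    using PDL.subst[OF assms(2), of \<sigma> p q] assms(3)[of \<sigma> p q] by (simp add: \<sigma>_def)
qed

text \<open>
  The tautologies among the axioms are box-free. A formula with boxes that is valid for purely
  propositional reasons is recovered as a substitution instance of its skeleton.
\<close>

primrec skeleton_atoms :: "('a, 'p) form \<Rightarrow> ('a, 'p) form set" where
  "skeleton_atoms (Var p) = {Var p}"
| "skeleton_atoms Zero = {}"
| "skeleton_atoms (Neg \<phi>) = skeleton_atoms \<phi>"
| "skeleton_atoms (Imp \<phi> \<psi>) = skeleton_atoms \<phi> \<union> skeleton_atoms \<psi>"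
| "skeleton_atoms (Box \<alpha> \<phi>) = {Box \<alpha> \<phi>}"

primrec skeleton :: "(('a, 'p) form \<Rightarrow> 'p) \<Rightarrow> ('a, 'p) form \<Rightarrow> ('a, 'p) form" where
  "skeleton f (Var p) = Var (f (Var p))"
| "skeleton f Zero = Zero"
| "skeleton f (Neg \<phi>) = Neg (skeleton f \<phi>)"
| "skeleton f (Imp \<phi> \<psi>) = Imp (skeleton f \<phi>) (skeleton f \<psi>)"
| "skeleton f (Box \<alpha> \<phi>) = Var (f (Box \<alpha> \<phi>))"

text \<open>Programs get the trivial predicate, so tests inside them yield no induction
  hypothesis.\<close>

lemma form_induct:
  assumes "\<And>p. P (Var p)" "P Zero" "\<And>\<phi>. P \<phi> \<Longrightarrow> P (Neg \<phi>)"
    and "\<And>\<phi> \<psi>. P \<phi> \<Longrightarrow> P \<psi> \<Longrightarrow> P (Imp \<phi> \<psi>)" "\<And>\<alpha> \<phi>. P \<phi> \<Longrightarrow> P (Box \<alpha> \<phi>)"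
  shows "P \<phi>"
  by (rule form.induct[where ?P2.0 = "\<lambda>_. True"]) (use assms in simp_all)

lemma finite_skeleton_atoms: "finite (skeleton_atoms \<phi>)"
  by (induction \<phi> rule: form_induct) auto

lemma valid_in_PDL:
  fixes \<theta> :: "('a, 'p) form"
  assumes "n \<ge> 1" "infinite (UNIV :: 'p set)" and valid: "\<And>u. luk_hom n u \<Longrightarrow> u \<theta> = 1"
  shows "\<theta> \<in> PDL n"
proof -
  \<comment> \<open>The finitely many variables and boxes of \<open>\<theta>\<close> are coded by
    distinct variables, which \<open>\<sigma>\<close> decodes.\<close>
  obtain f :: "('a, 'p) form \<Rightarrow> 'p" where f: "inj_on f (skeleton_atoms \<theta>)"
    using infinite_arbitrarily_large[OF assms(2)] finite_skeleton_atoms inj_on_iff_card_le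
    by (metis order_refl)
  define \<sigma> where "\<sigma> = inv_into (skeleton_atoms \<theta>) f"
  have subst: "skeleton_atoms \<psi> \<subseteq> skeleton_atoms \<theta> \<Longrightarrow> subst_form \<sigma> (skeleton f \<psi>) = \<psi>" for \<psi>
    by (induction \<psi> rule: form_induct) (auto simp: \<sigma>_def inv_into_f_f[OF f])
  have "luk_val v (skeleton f \<theta>) = 1" if v: "\<forall>p. v p \<in> luk_set n" for v
  proof -
    \<comment> \<open>Evaluating skeletons turns a valuation of the coding variables into a
      homomorphism on all formulas, to which validity of \<open>\<theta>\<close> applies.\<close>
    define u where "u \<psi> = luk_val v (skeleton f \<psi>)" for \<psi>
    have "luk_val v (skeleton f \<psi>) \<in> luk_set n" for \<psi>
      using v assms(1)
      by (induction \<psi> rule: form_induct)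
        (auto simp: luk_set_zero intro: luk_neg_in_luk_set luk_imp_in_luk_set)
    then have "luk_hom n u" by (simp add: luk_hom_def u_def)
    then show ?thesis using valid[of u] by (simp add: u_def)
  qed
  moreover have "box_free (skeleton f \<psi>)" for \<psi>
    by (induction \<psi> rule: form_induct) auto
  ultimately have "skeleton f \<theta> \<in> PDL n"
    by (auto intro: PDL.luk simp: luk_tautology_def)
  then show ?thesis
    using PDL.subst[of "skeleton f \<theta>" n \<sigma>] subst by simp
qed

section \<open>Canonical worlds\<close>

definition canonical :: "nat \<Rightarrow> (('a, 'p) form \<Rightarrow> real) set" where
  "canonical n = {u. luk_hom n u \<and> (\<forall>\<theta>\<in>PDL n. u \<theta> = 1)}"

text \<open>Deduction theorem of the finitely-valued logic: a premise \<open>\<gamma>\<close> is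
  discharged by placing it \<open>n\<close> times in front of \<open>\<phi>\<close>, and
  \<open>n\<close> uses of modus ponens remove it again.\<close>

lemma finite_consequence:
  fixes \<Gamma> :: "('a, 'p) form set"
  assumes "n \<ge> 1" "infinite (UNIV :: 'p set)" "PDL n \<subseteq> \<Gamma>"
    and mp: "\<And>\<psi> \<chi>. \<psi> \<in> \<Gamma> \<Longrightarrow> Imp \<psi> \<chi> \<in> \<Gamma> \<Longrightarrow> \<chi> \<in> \<Gamma>"
    and "finite F" "F \<subseteq> \<Gamma>" "\<And>u. luk_hom n u \<Longrightarrow> \<forall>\<gamma>\<in>F. u \<gamma> = 1 \<Longrightarrow> u \<phi> = 1"
  shows "\<phi> \<in> \<Gamma>"
  using assms(5-)
proof (induction F arbitrary: \<phi> rule: finite_induct)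
  case empty
  then show ?case using valid_in_PDL[OF assms(1,2)] assms(3) by blast
next
  case (insert \<gamma> F)
  have "(Imp \<gamma> ^^ n) \<phi> \<in> \<Gamma>"
  proof (rule insert.IH)
    fix u :: "('a, 'p) form \<Rightarrow> real"
    assume u: "luk_hom n u" "\<forall>\<gamma>\<in>F. u \<gamma> = 1"
    show "u ((Imp \<gamma> ^^ n) \<phi>) = 1"
    proof (cases "u \<gamma> = 1")
      case True
      then show ?thesis using insert.prems(2)[of u] u by (simp add: luk_hom_iter_Imp)
    next
      case False
      then have "1 - real n * (1 - u \<gamma>) \<le> 0"
        using luk_hom_Pow[OF u(1), of \<gamma> n] luk_hom_Pow_n[OF u(1) assms(1), of \<gamma>] by simp
      then show ?thesis
        using luk_hom_nonneg[OF u(1), of \<phi>] by (simp add: luk_hom_iter_Imp[OF u(1)])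
    qed
  qed (use insert.prems in auto)
  moreover have "(Imp \<gamma> ^^ k) \<phi> \<in> \<Gamma> \<Longrightarrow> \<phi> \<in> \<Gamma>" for k
    using insert.prems(1) by (induction k) (auto intro: mp)
  ultimately show ?case by blast
qed

section \<open>Compactness and the separation of theories from formulas\<close>

lemma compact_luk_homs: "compact {u :: ('a, 'p) form \<Rightarrow> real. luk_hom n u}"
proof -
  have "compactin (product_topology (\<lambda>_. euclidean) UNIV) (PiE UNIV (\<lambda>_ :: ('a, 'p) form. luk_set n))"
    unfolding compactin_PiE using finite_imp_compact[OF finite_luk_set] by simp
  then have 1: "compact {u :: ('a, 'p) form \<Rightarrow> real. \<forall>\<psi>. u \<psi> \<in> luk_set n}"
    by (simp add: euclidean_product_topology PiE_UNIV_domain Pi_def)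
  \<comment> \<open>The homomorphism laws are equations between continuous functions of single
    coordinates; Tychonoff has supplied compactness of the surrounding product.\<close>
  have "closed {u :: ('a, 'p) form \<Rightarrow> real. u Zero = 0 \<and>
      (\<forall>\<psi>. u (Neg \<psi>) = luk_neg (u \<psi>)) \<and> (\<forall>\<psi> \<chi>. u (Imp \<psi> \<chi>) = luk_imp (u \<psi>) (u \<chi>))}"
    unfolding luk_neg_def luk_imp_def
    by (intro closed_Collect_conj closed_Collect_all closed_Collect_eq continuous_intros
        continuous_on_product_coordinates)
  from compact_Int_closed[OF 1 this] show ?thesis
    by (rule back_subst) (auto simp: luk_hom_def)
qed

text \<open>By compactness finitely many members of \<open>\<Gamma>\<close> suffice, and for these
  \<open>finite_consequence\<close> yields a homomorphism. The lemma serves for the set of theorems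
  and for the set of formulas whose box has value 1 at a world.\<close>

lemma separating_world:
  fixes \<Gamma> :: "('a, 'p) form set"
  assumes "n \<ge> 1" "infinite (UNIV :: 'p set)" "PDL n \<subseteq> \<Gamma>"
    and mp: "\<And>\<psi> \<chi>. \<psi> \<in> \<Gamma> \<Longrightarrow> Imp \<psi> \<chi> \<in> \<Gamma> \<Longrightarrow> \<chi> \<in> \<Gamma>"
    and "\<phi> \<notin> \<Gamma>"
  obtains u where "u \<in> canonical n" "\<forall>\<gamma>\<in>\<Gamma>. u \<gamma> = 1" "u \<phi> \<noteq> 1"
proof -
  let ?H = "{u :: ('a, 'p) form \<Rightarrow> real. luk_hom n u}"
  \<comment> \<open>The condition \<open>u \<phi> \<noteq> 1\<close> is replaced by a visibly closed
    one that is equivalent on the chain.\<close>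
  define D where "D = insert {u. u \<phi> \<le> 1 - 1 / n} ((\<lambda>\<gamma>. {u :: ('a, 'p) form \<Rightarrow> real. u \<gamma> = 1}) ` \<Gamma>)"
  have "?H \<inter> \<Inter>D \<noteq> {}"
  proof (rule compact_imp_fip[OF compact_luk_homs])
    fix T assume "T \<in> D"
    then show "closed T"
      unfolding D_def
      by (auto intro!: closed_Collect_eq closed_Collect_le continuous_intros
          continuous_on_product_coordinates)
  next
    fix D' assume D': "finite D'" "D' \<subseteq> D"
    then have "finite (D' - {{u. u \<phi> \<le> 1 - 1 / n}})"
      "D' - {{u. u \<phi> \<le> 1 - 1 / n}} \<subseteq> (\<lambda>\<gamma>. {u :: ('a, 'p) form \<Rightarrow> real. u \<gamma> = 1}) ` \<Gamma>"
      by (auto simp: D_def)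
    then obtain F where F: "F \<subseteq> \<Gamma>" "finite F"
      "D' - {{u. u \<phi> \<le> 1 - 1 / n}} = (\<lambda>\<gamma>. {u. u \<gamma> = 1}) ` F"
      by (meson finite_subset_image)
    have "\<exists>u. luk_hom n u \<and> (\<forall>\<gamma>\<in>F. u \<gamma> = 1) \<and> u \<phi> \<noteq> 1"
    proof (rule ccontr)
      assume no_hom: "\<not> ?thesis"
      have "\<phi> \<in> \<Gamma>"
      proof (rule finite_consequence[OF assms(1-3) _ F(2,1)])
        show "\<chi> \<in> \<Gamma>" if "\<psi> \<in> \<Gamma>" "Imp \<psi> \<chi> \<in> \<Gamma>" for \<psi> \<chi>
          using that by (rule mp)
      qed (use no_hom in blast)
      with assms(5) show False ..
    qed
    then obtain u where u: "luk_hom n u" "\<forall>\<gamma>\<in>F. u \<gamma> = 1" "u \<phi> \<noteq> 1"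
      by blast
    have "u \<phi> \<le> 1 - 1 / n"
      using luk_set_gap[OF luk_hom_in_luk_set[OF u(1)] luk_set_one[OF assms(1)], of \<phi>] luk_hom_le_one[OF u(1), of \<phi>] u(3)
      by simp
    then have "u \<in> ?H \<inter> \<Inter>D'"
      using u F(3) by blast
    then show "?H \<inter> \<Inter>D' \<noteq> {}" by blast
  qed
  then obtain u where "luk_hom n u" "\<forall>\<gamma>\<in>\<Gamma>. u \<gamma> = 1" "u \<phi> \<le> 1 - 1 / n"
    unfolding D_def by blast
  moreover from this have "u \<phi> \<noteq> 1" using assms(1) by auto
  moreover have "u \<in> canonical n"
    using calculation assms(3) by (auto simp: canonical_def)
  ultimately show thesis using that by blast
qed


section \<open>Values of boxed formulas at one canonical world\<close>

context
  fixes n :: nat and u :: "('a, 'p) form \<Rightarrow> real"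
  assumes n: "n \<ge> 1" and inf: "infinite (UNIV :: 'p set)" and u: "u \<in> canonical n"
begin

lemma canonical_luk_hom: "luk_hom n u"
  using u by (simp add: canonical_def)

lemma canonical_PDL: "\<theta> \<in> PDL n \<Longrightarrow> u \<theta> = 1"
  using u by (simp add: canonical_def)

lemmas canonical_Imp = luk_hom_Imp[OF canonical_luk_hom]
  and canonical_Equ = luk_hom_Equ[OF canonical_luk_hom]
  and canonical_le_one = luk_hom_le_one[OF canonical_luk_hom]
  and canonical_nonneg = luk_hom_nonneg[OF canonical_luk_hom]

lemma canonical_mp: "u \<psi> = 1 \<Longrightarrow> u (Imp \<psi> \<chi>) = 1 \<Longrightarrow> u \<chi> = 1"
  using canonical_le_one[of \<chi>] by (simp add: canonical_Imp min_def split: if_splits)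

lemma canonical_K:
  assumes "u (Box \<alpha> (Imp \<psi> \<chi>)) = 1" "u (Box \<alpha> \<psi>) = 1"
  shows "u (Box \<alpha> \<chi>) = 1"
proof -
  have "Imp (Box \<alpha> (Imp \<psi> \<chi>)) (Imp (Box \<alpha> \<psi>) (Box \<alpha> \<chi>)) \<in> PDL n"
    by (rule PDL_instance2[where \<alpha> = \<alpha>
        and A = "\<lambda>\<psi> \<chi>. Imp (Box \<alpha> (Imp \<psi> \<chi>)) (Imp (Box \<alpha> \<psi>) (Box \<alpha> \<chi>))",
        OF inf PDL.box_imp]) simp
  from canonical_mp[OF assms(1) canonical_PDL[OF this]] show ?thesis
    by (rule canonical_mp[OF assms(2)])
qed

lemma canonical_box_Oplus: "u (Box \<alpha> (Oplus \<psi> \<psi>)) = u (Oplus (Box \<alpha> \<psi>) (Box \<alpha> \<psi>))"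
  unfolding canonical_Equ[symmetric]
  by (rule canonical_PDL, rule PDL_instance1[where \<alpha> = \<alpha> and \<beta> = \<alpha>
        and A = "\<lambda>\<psi>. Equ (Box \<alpha> (Oplus \<psi> \<psi>)) (Oplus (Box \<alpha> \<psi>) (Box \<alpha> \<psi>))",
        OF inf PDL.box_oplus]) simp

lemma canonical_box_Odot: "u (Box \<alpha> (Odot \<psi> \<psi>)) = u (Odot (Box \<alpha> \<psi>) (Box \<alpha> \<psi>))"
  unfolding canonical_Equ[symmetric]
  by (rule canonical_PDL, rule PDL_instance1[where \<alpha> = \<alpha> and \<beta> = \<alpha>
        and A = "\<lambda>\<psi>. Equ (Box \<alpha> (Odot \<psi> \<psi>)) (Odot (Box \<alpha> \<psi>) (Box \<alpha> \<psi>))",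
        OF inf PDL.box_odot]) simp

lemma canonical_Choice: "u (Box (Choice \<alpha> \<beta>) \<psi>) = min (u (Box \<alpha> \<psi>)) (u (Box \<beta> \<psi>))"
proof -
  have "Equ (Box (Choice \<alpha> \<beta>) \<psi>) (And (Box \<alpha> \<psi>) (Box \<beta> \<psi>)) \<in> PDL n"
    by (rule PDL_instance1[where \<alpha> = \<alpha> and \<beta> = \<beta>
        and A = "\<lambda>\<psi>. Equ (Box (Choice \<alpha> \<beta>) \<psi>) (And (Box \<alpha> \<psi>) (Box \<beta> \<psi>))",
        OF inf PDL.choice]) simp
  from canonical_PDL[OF this] show ?thesis
    unfolding canonical_Equ luk_hom_And[OF canonical_luk_hom] .
qed

lemma canonical_Seq: "u (Box (Seq \<alpha> \<beta>) \<psi>) = u (Box \<alpha> (Box \<beta> \<psi>))"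
  unfolding canonical_Equ[symmetric]
  by (rule canonical_PDL, rule PDL_instance1[where \<alpha> = \<alpha> and \<beta> = \<beta>
        and A = "\<lambda>\<psi>. Equ (Box (Seq \<alpha> \<beta>) \<psi>) (Box \<alpha> (Box \<beta> \<psi>))", OF inf PDL.seq]) simp

lemma canonical_Test: "u (Box (Test \<chi>) \<psi>) = (if u \<chi> = 1 then u \<psi> else 1)"
proof -
  \<comment> \<open>Here the program itself contains the formula to be substituted, so no program
    has to stay fixed; \<open>Test Zero\<close> is a dummy.\<close>
  have "Equ (Box (Test \<chi>) \<psi>) (Or (Neg (Pow \<chi> n)) \<psi>) \<in> PDL n"
    by (rule PDL_instance2[where \<alpha> = "Test Zero"
        and A = "\<lambda>\<chi> \<psi>. Equ (Box (Test \<chi>) \<psi>) (Or (Neg (Pow \<chi> n)) \<psi>)", OF inf PDL.test])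
      (simp add: subst_Pow)
  then have "u (Box (Test \<chi>) \<psi>) = u (Or (Neg (Pow \<chi> n)) \<psi>)"
    using canonical_PDL canonical_Equ by blast
  then show ?thesis
    unfolding luk_hom_Or[OF canonical_luk_hom]
      luk_hom_Neg[OF canonical_luk_hom] luk_hom_Pow_n[OF canonical_luk_hom n]
    using canonical_nonneg[of \<psi>] canonical_le_one[of \<psi>] by auto
qed

lemma canonical_Star_unfold:
  "u (Box (Star \<alpha>) \<psi>) = min (u \<psi>) (u (Box \<alpha> (Box (Star \<alpha>) \<psi>)))"
proof -
  have "Equ (Box (Star \<alpha>) \<psi>) (And \<psi> (Box \<alpha> (Box (Star \<alpha>) \<psi>))) \<in> PDL n"
    by (rule PDL_instance1[where \<alpha> = \<alpha> and \<beta> = \<alpha>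
        and A = "\<lambda>\<psi>. Equ (Box (Star \<alpha>) \<psi>) (And \<psi> (Box \<alpha> (Box (Star \<alpha>) \<psi>)))",
        OF inf PDL.star_unfold]) simp
  from canonical_PDL[OF this] show ?thesis
    unfolding canonical_Equ luk_hom_And[OF canonical_luk_hom] .
qed

lemma canonical_Star_induct:
  assumes "u \<psi> = 1" "u (Box (Star \<alpha>) (Pow (Imp \<psi> (Box \<alpha> \<psi>)) n)) = 1"
  shows "u (Box (Star \<alpha>) \<psi>) = 1"
proof -
  have "Imp (And \<psi> (Box (Star \<alpha>) (Pow (Imp \<psi> (Box \<alpha> \<psi>)) n))) (Box (Star \<alpha>) \<psi>) \<in> PDL n"
    by (rule PDL_instance1[where \<alpha> = \<alpha> and \<beta> = \<alpha>
        and A = "\<lambda>\<psi>. Imp (And \<psi> (Box (Star \<alpha>) (Pow (Imp \<psi> (Box \<alpha> \<psi>)) n))) (Box (Star \<alpha>) \<psi>)",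
        OF inf PDL.star_induct]) (simp add: subst_Pow)
  moreover have "u (And \<psi> (Box (Star \<alpha>) (Pow (Imp \<psi> (Box \<alpha> \<psi>)) n))) = 1"
    unfolding luk_hom_And[OF canonical_luk_hom] using assms by simp
  ultimately show ?thesis
    using canonical_mp canonical_PDL by blast
qed

text \<open>Both doubling maps commute with the box, hence so do their compositions; this moves
  thresholds under a box.\<close>

lemma canonical_box_iter_double:
  "u (Box \<alpha> (iter_double bs \<psi>)) = real_iter_double bs (u (Box \<alpha> \<psi>))"
proof -
  have "u (Box \<alpha> (iter_double bs \<psi>)) = u (iter_double bs (Box \<alpha> \<psi>))"
  proof (induction bs)
    case (Cons b bs)
    show ?case
      by (cases b) (simp_all only: iter_double.simps Let_def if_True if_False
        canonical_box_Oplus canonical_box_Odot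
        luk_hom_Oplus[OF canonical_luk_hom] luk_hom_Odot[OF canonical_luk_hom] Cons)
  qed simp
  then show ?thesis
    by (simp add: luk_hom_iter_double[OF canonical_luk_hom])
qed

end

text \<open>Only value 1 is transferred, as in the two-valued case. The bound for the other values
  is derived in \<open>canonical_box_le\<close>.\<close>

definition canonical_rel ::
  "nat \<Rightarrow> ('a, 'p) prog \<Rightarrow> ((('a, 'p) form \<Rightarrow> real) \<times> (('a, 'p) form \<Rightarrow> real)) set" where
  "canonical_rel n \<alpha> =
     {(u, v) \<in> canonical n \<times> canonical n. \<forall>\<psi>. u (Box \<alpha> \<psi>) = 1 \<longrightarrow> v \<psi> = 1}"

lemma canonical_relD:
  assumes "(u, v) \<in> canonical_rel n \<alpha>"
  shows "u \<in> canonical n" "v \<in> canonical n" "u (Box \<alpha> \<psi>) = 1 \<Longrightarrow> v \<psi> = 1"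
  using assms by (auto simp: canonical_rel_def)

text \<open>The formulas whose box has value 1 at \<open>u\<close> contain all theorems by
  necessitation and are closed under modus ponens by axiom K, so a formula outside of them is
  refuted at some successor.\<close>

lemma canonical_box_eq_one_iff:
  fixes u :: "('a, 'p) form \<Rightarrow> real"
  assumes "n \<ge> 1" "infinite (UNIV :: 'p set)" "u \<in> canonical n"
  shows "u (Box \<alpha> \<psi>) = 1 \<longleftrightarrow> (\<forall>v. (u, v) \<in> canonical_rel n \<alpha> \<longrightarrow> v \<psi> = 1)"
proof (intro iffI allI impI)
  assume *: "\<forall>v. (u, v) \<in> canonical_rel n \<alpha> \<longrightarrow> v \<psi> = 1"
  show "u (Box \<alpha> \<psi>) = 1"
  proof (rule ccontr)
    let ?\<Gamma> = "{\<chi>. u (Box \<alpha> \<chi>) = 1}"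
    assume "u (Box \<alpha> \<psi>) \<noteq> 1"
    then have "\<psi> \<notin> ?\<Gamma>" by simp
    moreover have "PDL n \<subseteq> ?\<Gamma>"
      using canonical_PDL[OF assms] PDL.nec by auto
    moreover have "\<chi>' \<in> ?\<Gamma>" if "\<chi> \<in> ?\<Gamma>" "Imp \<chi> \<chi>' \<in> ?\<Gamma>" for \<chi> \<chi>'
      using that canonical_K[OF assms] by blast
    ultimately obtain v where "v \<in> canonical n" "\<forall>\<chi>\<in>?\<Gamma>. v \<chi> = 1" "v \<psi> \<noteq> 1"
      using separating_world[OF assms(1,2), of ?\<Gamma> \<psi>] by blast
    with * assms(3) show False by (simp add: canonical_rel_def)
  qed
qed (auto dest: canonical_relD)

text \<open>Otherwise a threshold sends \<open>v \<psi>\<close> to 0 and the value of the box to 1;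
  the box of the threshold formula then has value 1, which forces value 1 at
  \<open>v\<close>.\<close>

lemma canonical_box_le:
  fixes u :: "('a, 'p) form \<Rightarrow> real"
  assumes "n \<ge> 1" "infinite (UNIV :: 'p set)" "(u, v) \<in> canonical_rel n \<alpha>"
  shows "u (Box \<alpha> \<psi>) \<le> v \<psi>"
proof (rule ccontr)
  note u = canonical_relD(1)[OF assms(3)] and v = canonical_relD(2)[OF assms(3)]
  note range = canonical_le_one[OF assms(1,2) u] canonical_nonneg[OF assms(1,2) v]
  assume "\<not> u (Box \<alpha> \<psi>) \<le> v \<psi>"
  then obtain bs where bs:
    "\<And>x. 0 \<le> x \<Longrightarrow> x \<le> v \<psi> \<Longrightarrow> real_iter_double bs x = 0"
    "\<And>x. u (Box \<alpha> \<psi>) \<le> x \<Longrightarrow> x \<le> 1 \<Longrightarrow> real_iter_double bs x = 1"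
    using threshold[of "v \<psi>" "u (Box \<alpha> \<psi>)"] range by (metis not_le)
  then have "u (Box \<alpha> (iter_double bs \<psi>)) = 1"
    using range by (simp add: canonical_box_iter_double[OF assms(1,2) u])
  then have "v (iter_double bs \<psi>) = 1"
    using assms(3) by (simp add: canonical_relD)
  then show False
    using bs(1)[of "v \<psi>"] range
    by (simp add: luk_hom_iter_double[OF canonical_luk_hom[OF assms(1,2) v]])
qed

text \<open>A threshold between the value \<open>r\<close> of the box and its upper neighbour has a
  box of value 0. A successor refuting it lies below \<open>r + 1 / n\<close>, hence at most at
  \<open>r\<close>, and \<open>canonical_box_le\<close> gives equality.\<close>

lemma canonical_box_attained:
  fixes u :: "('a, 'p) form \<Rightarrow> real"
  assumes "n \<ge> 1" "infinite (UNIV :: 'p set)" "u \<in> canonical n" "u (Box \<alpha> \<psi>) \<noteq> 1"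
  obtains v where "(u, v) \<in> canonical_rel n \<alpha>" "v \<psi> = u (Box \<alpha> \<psi>)"
proof -
  let ?r = "u (Box \<alpha> \<psi>)"
  note range = canonical_le_one[OF assms(1-3)] canonical_nonneg[OF assms(1-3)]
  note in_set = luk_hom_in_luk_set[OF canonical_luk_hom[OF assms(1,2)]]
  have "?r < 1"
    using range(1)[of "Box \<alpha> \<psi>"] assms(4) by simp
  then have "?r + 1 / n \<le> 1"
    using luk_set_gap[OF in_set[OF assms(3)] luk_set_one[OF assms(1)]] by blast
  then obtain bs where bs:
    "\<And>x. 0 \<le> x \<Longrightarrow> x \<le> ?r \<Longrightarrow> real_iter_double bs x = 0"
    "\<And>x. ?r + 1 / n \<le> x \<Longrightarrow> x \<le> 1 \<Longrightarrow> real_iter_double bs x = 1"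
    using threshold[of ?r "?r + 1 / n"] range(2)[of "Box \<alpha> \<psi>"] assms(1) by auto
  have "u (Box \<alpha> (iter_double bs \<psi>)) \<noteq> 1"
    using bs(1)[of ?r] range(2) by (simp add: canonical_box_iter_double[OF assms(1-3)])
  then obtain v where v: "(u, v) \<in> canonical_rel n \<alpha>" "v (iter_double bs \<psi>) \<noteq> 1"
    using canonical_box_eq_one_iff[OF assms(1-3)] by blast
  note v' = canonical_relD(2)[OF v(1)]
  have "v \<psi> < ?r + 1 / n"
    using v(2) bs(2)[of "v \<psi>"] canonical_le_one[OF assms(1,2) v', of \<psi>]
    by (auto simp: luk_hom_iter_double[OF canonical_luk_hom[OF assms(1,2) v']] not_le[symmetric])
  then have "v \<psi> \<le> ?r"
    using luk_set_gap[OF in_set[OF assms(3)] in_set[OF v'], of "Box \<alpha> \<psi>" \<psi>] by linarith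
  then show thesis
    using that v(1) canonical_box_le[OF assms(1,2) v(1), of \<psi>] by force
qed

section \<open>Fischer-Ladner closure\<close>

text \<open>One step of Fischer-Ladner decomposition. For \<open>Star\<close> the part is larger
  than the whole, so finiteness of the closure is obtained from \<open>FL\<close> instead.\<close>

fun direct_parts :: "('a, 'p) form \<Rightarrow> ('a, 'p) form set" where
  "direct_parts (Neg \<phi>) = {\<phi>}"
| "direct_parts (Imp \<phi> \<psi>) = {\<phi>, \<psi>}"
| "direct_parts (Box (Atom a) \<phi>) = {\<phi>}"
| "direct_parts (Box (Test \<chi>) \<phi>) = {\<phi>, \<chi>}"
| "direct_parts (Box (Seq \<alpha> \<beta>) \<phi>) = {\<phi>, Box \<beta> \<phi>, Box \<alpha> (Box \<beta> \<phi>)}"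
| "direct_parts (Box (Choice \<alpha> \<beta>) \<phi>) = {\<phi>, Box \<alpha> \<phi>, Box \<beta> \<phi>}"
| "direct_parts (Box (Star \<alpha>) \<phi>) = {\<phi>, Box \<alpha> (Box (Star \<alpha>) \<phi>)}"
| "direct_parts _ = {}"

text \<open>\<open>FL_box\<close> recurses on the program and only carries the boxed formula along,
  which makes the unfolding of \<open>Star\<close> terminate. The parts of the carried formula are
  added by \<open>FL\<close>.\<close>

fun FL :: "('a, 'p) form \<Rightarrow> ('a, 'p) form set"
  and FL_box :: "('a, 'p) prog \<Rightarrow> ('a, 'p) form \<Rightarrow> ('a, 'p) form set"
where
  "FL (Var p) = {Var p}"
| "FL Zero = {Zero}"
| "FL (Neg \<phi>) = insert (Neg \<phi>) (FL \<phi>)"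
| "FL (Imp \<phi> \<psi>) = insert (Imp \<phi> \<psi>) (FL \<phi> \<union> FL \<psi>)"
| "FL (Box \<alpha> \<phi>) = FL_box \<alpha> \<phi> \<union> FL \<phi>"
| "FL_box (Atom a) \<phi> = {Box (Atom a) \<phi>}"
| "FL_box (Test \<chi>) \<phi> = insert (Box (Test \<chi>) \<phi>) (FL \<chi>)"
| "FL_box (Seq \<alpha> \<beta>) \<phi> = insert (Box (Seq \<alpha> \<beta>) \<phi>) (FL_box \<alpha> (Box \<beta> \<phi>) \<union> FL_box \<beta> \<phi>)"
| "FL_box (Choice \<alpha> \<beta>) \<phi> = insert (Box (Choice \<alpha> \<beta>) \<phi>) (FL_box \<alpha> \<phi> \<union> FL_box \<beta> \<phi>)"
| "FL_box (Star \<alpha>) \<phi> = insert (Box (Star \<alpha>) \<phi>) (FL_box \<alpha> (Box (Star \<alpha>) \<phi>))"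

lemma finite_FL: "finite (FL \<phi>)" "finite (FL_box \<alpha> \<psi>)"
  for \<phi> :: "('a, 'p) form" and \<alpha> :: "('a, 'p) prog"
  by (induction \<phi> and \<alpha> arbitrary: and \<psi>) auto

lemma FL_refl: "\<phi> \<in> FL \<phi>" "Box \<alpha> \<psi> \<in> FL_box \<alpha> \<psi>"
  for \<phi> :: "('a, 'p) form" and \<alpha> :: "('a, 'p) prog"
  by (induction \<phi> and \<alpha> arbitrary: and \<psi>) auto

text \<open>The carried formula \<open>\<psi>\<close> has to be allowed as a part in the second
  claim; in the recursive calls it is a box that the enclosing closure contains, or
  \<open>\<psi>\<close> itself.\<close>

lemma FL_closed:
  fixes \<phi> :: "('a, 'p) form" and \<alpha> :: "('a, 'p) prog"
  shows "\<chi> \<in> FL \<phi> \<Longrightarrow> direct_parts \<chi> \<subseteq> FL \<phi>"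
    and "\<chi> \<in> FL_box \<alpha> \<psi> \<Longrightarrow> direct_parts \<chi> \<subseteq> insert \<psi> (FL_box \<alpha> \<psi>)"
proof (induction \<phi> and \<alpha> arbitrary: \<chi> and \<chi> \<psi>)
  case (Neg \<phi>)
  show ?case
    using Neg.prems Neg.IH[of \<chi>]
      FL_refl(1)[of \<phi>] by auto
next
  case (Imp \<phi> \<psi>)
  show ?case
    using Imp.prems Imp.IH(1)[of \<chi>] Imp.IH(2)[of \<chi>]
      FL_refl(1)[of \<phi>] FL_refl(1)[of \<psi>] by auto
next
  case (Box \<alpha> \<phi>)
  show ?case
    using Box.prems Box.IH(1)[of \<chi> \<phi>] Box.IH(2)[of \<chi>]
      FL_refl(1)[of \<phi>] by auto
next
  case (Test \<chi>')
  show ?case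
    using Test.prems Test.IH[of \<chi>]
      FL_refl(1)[of \<chi>'] by auto
next
  case (Seq \<alpha> \<beta>)
  show ?case
    using Seq.prems Seq.IH(1)[of \<chi> "Box \<beta> \<psi>"] Seq.IH(2)[of \<chi> \<psi>]
      FL_refl(2)[of \<alpha> "Box \<beta> \<psi>"] FL_refl(2)[of \<beta> \<psi>] by auto
next
  case (Choice \<alpha> \<beta>)
  show ?case
    using Choice.prems Choice.IH(1)[of \<chi> \<psi>] Choice.IH(2)[of \<chi> \<psi>]
      FL_refl(2)[of \<alpha> \<psi>] FL_refl(2)[of \<beta> \<psi>] by auto
next
  case (Star \<alpha>)
  show ?case
    using Star.prems Star.IH[of \<chi> "Box (Star \<alpha>) \<psi>"]
      FL_refl(2)[of \<alpha> "Box (Star \<alpha>) \<psi>"] by auto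
qed auto

section \<open>Filtration\<close>

lemma rel_subset_worlds:
  assumes "\<And>a. acc M a \<subseteq> worlds M \<times> worlds M"
  shows "rel M \<alpha> \<subseteq> worlds M \<times> worlds M"
  by (induction \<alpha> rule: prog.induct[where ?P1.0 = "\<lambda>_. True"]) (use assms in auto)

text \<open>For \<open>r = 1\<close> there may be no successor, and the default value 1 applies; if
  there is one, the outer two premises give its value.\<close>

lemma val_Box_eqI:
  assumes "\<And>x. (w, x) \<in> rel M \<alpha> \<Longrightarrow> r \<le> val M \<phi> x"
    and "r \<noteq> 1 \<Longrightarrow> \<exists>x. (w, x) \<in> rel M \<alpha> \<and> val M \<phi> x = r"
    and "\<And>x. (w, x) \<in> rel M \<alpha> \<Longrightarrow> val M \<phi> x \<le> 1"
  shows "val M (Box \<alpha> \<phi>) w = r"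
proof (cases "\<exists>x. (w, x) \<in> rel M \<alpha>")
  case True
  then obtain x where "(w, x) \<in> rel M \<alpha>" "val M \<phi> x = r"
    using assms by (metis order_antisym)
  then have "Inf {val M \<phi> v | v. (w, v) \<in> rel M \<alpha>} = r"
    using assms(1) by (intro cInf_eq_minimum) auto
  then show ?thesis using True by simp
qed (use assms(2) in auto)

text \<open>A collapsed world is the table of values on \<open>C\<close>. There are finitely many
  such tables, and \<open>g\<close> codes them in the prescribed type \<open>'w\<close>.\<close>

locale filtration =
  fixes n :: nat and C :: "('a, 'p) form set" and g :: "(('a, 'p) form \<Rightarrow> real) \<Rightarrow> 'w"
  assumes n: "n \<ge> 1" and inf: "infinite (UNIV :: 'p set)" and finite_C: "finite C"
    and closed: "\<And>\<psi>. \<psi> \<in> C \<Longrightarrow> direct_parts \<psi> \<subseteq> C"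
    and inj_g: "inj_on g (PiE C (\<lambda>_. luk_set n))"
begin

definition collapse :: "(('a, 'p) form \<Rightarrow> real) \<Rightarrow> 'w" where
  "collapse u = g (restrict u C)"

lemma restrict_canonical: "u \<in> canonical n \<Longrightarrow> restrict u C \<in> PiE C (\<lambda>_. luk_set n)"
  using luk_hom_in_luk_set[OF canonical_luk_hom[OF n inf]] by auto

lemma collapse_eq_iff:
  assumes "u \<in> canonical n" "v \<in> canonical n"
  shows "collapse u = collapse v \<longleftrightarrow> (\<forall>\<psi>\<in>C. u \<psi> = v \<psi>)"
  unfolding collapse_def inj_on_eq_iff[OF inj_g restrict_canonical[OF assms(1)] restrict_canonical[OF assms(2)]]
  by (metis restrict_apply' restrict_ext)

lemma finite_collapse: "finite (collapse ` canonical n)"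
proof (rule finite_subset)
  show "collapse ` canonical n \<subseteq> g ` PiE C (\<lambda>_. luk_set n)"
    using restrict_canonical by (auto simp: collapse_def)
  show "finite (g ` PiE C (\<lambda>_. luk_set n))"
    using finite_C finite_luk_set by (intro finite_imageI finite_PiE) auto
qed

section \<open>Two-valued formulas defining sets of collapsed worlds\<close>

lemma definable_threshold:
  fixes \<psi> :: "('a, 'p) form"
  assumes "r \<in> luk_set n"
  shows "\<exists>\<chi>. \<forall>w\<in>canonical n. w \<chi> = of_bool (r \<le> w \<psi>)"
\<comment> \<open>Below 0 there is no chain value to separate from, but the condition then always
  holds.\<close>
proof (cases "r = 0")
  case True
  have "w One = of_bool (r \<le> w \<psi>)" if "w \<in> canonical n" for w
    using True luk_hom_One[OF canonical_luk_hom[OF n inf that]] canonical_nonneg[OF n inf that, of \<psi>]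
    by simp
  then show ?thesis by blast
next
  case False
  then have "0 \<le> r - 1 / n" "r \<le> 1"
    using luk_set_gap[OF luk_set_zero assms] luk_set_bounds[OF assms] by auto
  then obtain bs where bs:
    "\<And>x. 0 \<le> x \<Longrightarrow> x \<le> r - 1 / n \<Longrightarrow> real_iter_double bs x = 0"
    "\<And>x. r \<le> x \<Longrightarrow> x \<le> 1 \<Longrightarrow> real_iter_double bs x = 1"
    using threshold[of "r - 1 / n" r] n by auto
  have "w (iter_double bs \<psi>) = of_bool (r \<le> w \<psi>)" if "w \<in> canonical n" for w
  proof -
    note w = canonical_luk_hom[OF n inf that]
    show ?thesis
    proof (cases "r \<le> w \<psi>")
      case False
      then have "w \<psi> \<le> r - 1 / n"
        using luk_set_gap[OF luk_hom_in_luk_set[OF w] assms, of \<psi>] by auto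
      with False show ?thesis
        using bs(1) luk_hom_nonneg[OF w] by (simp add: luk_hom_iter_double[OF w])
    qed (use bs(2) luk_hom_le_one[OF w] in \<open>simp add: luk_hom_iter_double[OF w]\<close>)
  qed
  then show ?thesis by blast
qed

text \<open>An upper bound on \<open>\<psi>\<close> is a lower bound on its negation, so two
  thresholds suffice.\<close>

lemma definable_value:
  fixes \<psi> :: "('a, 'p) form"
  assumes "r \<in> luk_set n"
  shows "\<exists>\<chi>. \<forall>w\<in>canonical n. w \<chi> = of_bool (w \<psi> = r)"
proof -
  obtain \<chi>1 where \<chi>1: "\<forall>w\<in>canonical n. w \<chi>1 = of_bool (r \<le> w \<psi>)"
    using definable_threshold[OF assms] by blast
  obtain \<chi>2 where \<chi>2: "\<forall>w\<in>canonical n. w \<chi>2 = of_bool (luk_neg r \<le> w (Neg \<psi>))"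
    using definable_threshold[OF luk_neg_in_luk_set[OF n assms]] by blast
  have "w (And \<chi>1 \<chi>2) = of_bool (w \<psi> = r)" if "w \<in> canonical n" for w
  proof -
    note w = canonical_luk_hom[OF n inf that]
    show ?thesis
      unfolding luk_hom_And[OF w] using bspec[OF \<chi>1 that] bspec[OF \<chi>2 that]
      by (auto simp: luk_neg_def luk_hom_Neg[OF w])
  qed
  then show ?thesis by blast
qed

lemma definable_agreement:
  fixes D :: "('a, 'p) form set"
  assumes "finite D" "\<And>\<psi>. f \<psi> \<in> luk_set n"
  shows "\<exists>\<chi>. \<forall>w\<in>canonical n. w \<chi> = of_bool (\<forall>\<psi>\<in>D. w \<psi> = f \<psi>)"
  using assms(1)
proof induction
  case empty
  have "w One = of_bool (\<forall>\<psi>\<in>{}. w \<psi> = f \<psi>)" if "w \<in> canonical n" for w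
    using luk_hom_One[OF canonical_luk_hom[OF n inf that]] by simp
  then show ?case by blast
next
  case (insert \<psi> D)
  then obtain \<chi>1 where \<chi>1: "\<forall>w\<in>canonical n. w \<chi>1 = of_bool (\<forall>\<psi>\<in>D. w \<psi> = f \<psi>)"
    by blast
  obtain \<chi>2 where \<chi>2: "\<forall>w\<in>canonical n. w \<chi>2 = of_bool (w \<psi> = f \<psi>)"
    using definable_value[OF assms(2)] by blast
  have "w (And \<chi>1 \<chi>2) = of_bool (\<forall>\<psi>\<in>insert \<psi> D. w \<psi> = f \<psi>)" if "w \<in> canonical n" for w
    unfolding luk_hom_And[OF canonical_luk_hom[OF n inf that]]
    using bspec[OF \<chi>1 that] bspec[OF \<chi>2 that] by auto
  then show ?case by blast
qed

text \<open>Each of the finitely many collapsed worlds is defined by its values on \<open>C\<close>;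
  a finite disjunction handles sets.\<close>

lemma definable:
  "\<exists>\<chi>. \<forall>w\<in>canonical n. w \<chi> = of_bool (collapse w \<in> Y)"
proof -
  have "\<exists>\<chi>. \<forall>w\<in>canonical n. w \<chi> = of_bool (collapse w \<in> Z)"
    if "finite Z" "Z \<subseteq> collapse ` canonical n" for Z
    using that
  proof induction
    case empty
    have "w Zero = of_bool (collapse w \<in> {})" if "w \<in> canonical n" for w
      using luk_hom_Zero[OF canonical_luk_hom[OF n inf that]] by simp
    then show ?case by blast
  next
    case (insert x Z)
    then obtain \<chi>1 where \<chi>1: "\<forall>w\<in>canonical n. w \<chi>1 = of_bool (collapse w \<in> Z)"
      by blast
    obtain u where u: "u \<in> canonical n" "x = collapse u"
      using insert.prems by blast
    obtain \<chi>2 where \<chi>2: "\<forall>w\<in>canonical n. w \<chi>2 = of_bool (\<forall>\<psi>\<in>C. w \<psi> = u \<psi>)"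
      using definable_agreement[OF finite_C, of u,
          OF luk_hom_in_luk_set[OF canonical_luk_hom[OF n inf u(1)]]]
      by blast
    have "w (Or \<chi>1 \<chi>2) = of_bool (collapse w \<in> insert x Z)" if "w \<in> canonical n" for w
      unfolding luk_hom_Or[OF canonical_luk_hom[OF n inf that]]
      using bspec[OF \<chi>1 that] bspec[OF \<chi>2 that] u(2) collapse_eq_iff[OF that u(1)] by auto
    then show ?case by blast
  qed
  \<comment> \<open>Intersecting with the worlds makes \<open>Y\<close> finite and changes nothing
    at canonical worlds.\<close>
  from this[of "Y \<inter> collapse ` canonical n"] obtain \<chi> where
    \<chi>: "\<forall>w\<in>canonical n. w \<chi> = of_bool (collapse w \<in> Y \<inter> collapse ` canonical n)"
    using finite_collapse by blast
  have "w \<chi> = of_bool (collapse w \<in> Y)" if "w \<in> canonical n" for w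
    using bspec[OF \<chi> that] that by simp
  then show ?thesis by blast
qed

text \<open>The smallest filtration: atomic steps are images of canonical ones. The chosen
  representative does not matter, since those of one world agree on \<open>C\<close>; variables
  outside \<open>C\<close> get the default 0.\<close>

definition model :: "('w, 'a, 'p) kripke" where
  "model = \<lparr>worlds = collapse ` canonical n,
     acc = \<lambda>a. (\<lambda>(u, v). (collapse u, collapse v)) ` canonical_rel n (Atom a),
     valu = \<lambda>x p. if Var p \<in> C then (SOME u. u \<in> canonical n \<and> collapse u = x) (Var p) else 0\<rparr>"

lemma worlds_model: "worlds model = collapse ` canonical n"
  by (simp add: model_def)

lemma acc_model: "acc model a = (\<lambda>(u, v). (collapse u, collapse v)) ` canonical_rel n (Atom a)"
  by (simp add: model_def)

lemma valu_model:
  assumes "u \<in> canonical n"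
  shows "valu model (collapse u) p = (if Var p \<in> C then u (Var p) else 0)"
proof -
  let ?v = "SOME v. v \<in> canonical n \<and> collapse v = collapse u"
  have "?v \<in> canonical n \<and> collapse ?v = collapse u"
    by (rule someI[of _ u]) (use assms in simp)
  then have "\<forall>\<psi>\<in>C. ?v \<psi> = u \<psi>"
    using collapse_eq_iff[of ?v u] assms by blast
  then show ?thesis
    by (simp add: model_def)
qed

lemma acc_model_subset: "acc model a \<subseteq> worlds model \<times> worlds model"
  by (auto simp: worlds_model acc_model canonical_rel_def)

lemma kripke_model_model:
  fixes u :: "('a, 'p) form \<Rightarrow> real"
  assumes "u \<in> canonical n"
  shows "kripke_model n model"
proof -
  have "valu model w p \<in> luk_set n" if "w \<in> worlds model" for w p
  proof -
    from that obtain v where "v \<in> canonical n" "w = collapse v"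
      by (auto simp: worlds_model)
    then show ?thesis
      using luk_hom_in_luk_set[OF canonical_luk_hom[OF n inf], of v "Var p"]
      by (simp add: valu_model luk_set_zero)
  qed
  then show ?thesis
    using assms acc_model_subset by (auto simp: kripke_model_def worlds_model)
qed

lemma rel_model_subset: "rel model \<alpha> \<subseteq> collapse ` canonical n \<times> collapse ` canonical n"
  using rel_subset_worlds[OF acc_model_subset] by (simp add: worlds_model)

section \<open>The two filtration conditions, first that no canonical step is lost\<close>

definition includes_canonical :: "('a, 'p) prog \<Rightarrow> bool" where
  "includes_canonical \<alpha> \<longleftrightarrow>
     (\<forall>u v. (u, v) \<in> canonical_rel n \<alpha> \<longrightarrow> (collapse u, collapse v) \<in> rel model \<alpha>)"

text \<open>The opposite bound: the model has no step that violates a box. It is limited to boxes in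
  \<open>C\<close>, whose values the collapse preserves.\<close>

definition respects_boxes :: "('a, 'p) prog \<Rightarrow> bool" where
  "respects_boxes \<alpha> \<longleftrightarrow>
     (\<forall>\<phi> u v. Box \<alpha> \<phi> \<in> C \<longrightarrow> u \<in> canonical n \<longrightarrow> v \<in> canonical n \<longrightarrow>
        (collapse u, collapse v) \<in> rel model \<alpha> \<longrightarrow> u (Box \<alpha> \<phi>) \<le> v \<phi>)"

lemma includes_canonical_box:
  assumes "includes_canonical \<alpha>" "u \<in> canonical n"
    and "\<And>v. v \<in> canonical n \<Longrightarrow> (collapse u, collapse v) \<in> rel model \<alpha> \<Longrightarrow> v \<chi> = 1"
  shows "u (Box \<alpha> \<chi>) = 1"
  unfolding canonical_box_eq_one_iff[OF n inf assms(2)]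
proof (intro allI impI)
  fix v assume "(u, v) \<in> canonical_rel n \<alpha>"
  with assms(1) show "v \<chi> = 1"
    unfolding includes_canonical_def by (intro assms(3)) (auto dest: canonical_relD(2))
qed

text \<open>
  The converse of the previous lemma: it suffices to test the formula that defines the set of
  successors of a collapsed world.
\<close>

lemma includes_canonicalI:
  assumes "\<And>u \<chi>. u \<in> canonical n \<Longrightarrow>
    (\<And>v. v \<in> canonical n \<Longrightarrow> (collapse u, collapse v) \<in> rel model \<alpha> \<Longrightarrow> v \<chi> = 1) \<Longrightarrow>
    u (Box \<alpha> \<chi>) = 1"
  shows "includes_canonical \<alpha>"
  unfolding includes_canonical_def
proof (intro allI impI)
  fix u v assume uv: "(u, v) \<in> canonical_rel n \<alpha>"
  obtain \<chi> where \<chi>: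
    "\<forall>w\<in>canonical n. w \<chi> = of_bool (collapse w \<in> {x. (collapse u, x) \<in> rel model \<alpha>})"
    using definable by blast
  have "u (Box \<alpha> \<chi>) = 1"
  proof (rule assms)
    show "w \<chi> = 1" if "w \<in> canonical n" "(collapse u, collapse w) \<in> rel model \<alpha>" for w
      using bspec[OF \<chi> that(1)] that(2) by simp
  qed (rule canonical_relD(1)[OF uv])
  then have "v \<chi> = 1"
    by (rule canonical_relD(3)[OF uv])
  then show "(collapse u, collapse v) \<in> rel model \<alpha>"
    using bspec[OF \<chi> canonical_relD(2)[OF uv]] by (simp split: if_splits)
qed

text \<open>Arguing with the values of boxes avoids splitting a canonical step of
  \<open>Seq \<alpha> \<beta>\<close> at an intermediate canonical world.\<close>

lemma includes_canonical_Seq: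
  assumes "includes_canonical \<alpha>" "includes_canonical \<beta>"
  shows "includes_canonical (Seq \<alpha> \<beta>)"
proof (rule includes_canonicalI)
  fix u \<chi>
  assume u: "u \<in> canonical n"
    and *: "\<And>v. v \<in> canonical n \<Longrightarrow> (collapse u, collapse v) \<in> rel model (Seq \<alpha> \<beta>) \<Longrightarrow> v \<chi> = 1"
  have "u (Box \<alpha> (Box \<beta> \<chi>)) = 1"
  proof (rule includes_canonical_box[OF assms(1) u])
    fix w assume w: "w \<in> canonical n" "(collapse u, collapse w) \<in> rel model \<alpha>"
    show "w (Box \<beta> \<chi>) = 1"
      by (rule includes_canonical_box[OF assms(2) w(1)], rule *) (use w(2) in auto)
  qed
  then show "u (Box (Seq \<alpha> \<beta>) \<chi>) = 1"
    by (simp add: canonical_Seq[OF n inf u])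
qed

lemma includes_canonical_Choice:
  assumes "includes_canonical \<alpha>" "includes_canonical \<beta>"
  shows "includes_canonical (Choice \<alpha> \<beta>)"
proof (rule includes_canonicalI)
  fix u \<chi>
  assume u: "u \<in> canonical n"
    and *: "\<And>v. v \<in> canonical n \<Longrightarrow> (collapse u, collapse v) \<in> rel model (Choice \<alpha> \<beta>) \<Longrightarrow> v \<chi> = 1"
  have "u (Box \<alpha> \<chi>) = 1"
    by (rule includes_canonical_box[OF assms(1) u], rule *) simp_all
  moreover have "u (Box \<beta> \<chi>) = 1"
    by (rule includes_canonical_box[OF assms(2) u], rule *) simp_all
  ultimately show "u (Box (Choice \<alpha> \<beta>) \<chi>) = 1"
    by (simp add: canonical_Choice[OF n inf u])
qed

text \<open>The formula \<open>\<chi>\<close> defining the reachable worlds is preserved by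
  \<open>\<alpha>\<close> at every canonical world, so the induction axiom carries it from
  \<open>u\<close> to all canonical successors under \<open>Star \<alpha>\<close>.\<close>

lemma includes_canonical_Star:
  assumes "includes_canonical \<alpha>"
  shows "includes_canonical (Star \<alpha>)"
  unfolding includes_canonical_def
proof (intro allI impI)
  fix u v assume uv: "(u, v) \<in> canonical_rel n (Star \<alpha>)"
  note u = canonical_relD(1)[OF uv] and v = canonical_relD(2)[OF uv]
  let ?E = "{x. (collapse u, x) \<in> rel model (Star \<alpha>)}"
  obtain \<chi> where "\<forall>w\<in>canonical n. w \<chi> = of_bool (collapse w \<in> ?E)"
    using definable by blast
  note \<chi> = bspec[OF this]
  have invariant: "w (Imp \<chi> (Box \<alpha> \<chi>)) = 1" if w: "w \<in> canonical n" for w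
  proof (cases "collapse w \<in> ?E")
    case True
    have "w (Box \<alpha> \<chi>) = 1"
    proof (rule includes_canonical_box[OF assms w])
      fix w' assume "w' \<in> canonical n" "(collapse w, collapse w') \<in> rel model \<alpha>"
      with True show "w' \<chi> = 1"
        by (auto simp: \<chi> worlds_model intro: rtrancl_into_rtrancl)
    qed
    then show ?thesis
      using \<chi>[OF w] by (simp add: canonical_Imp[OF n inf w])
  next
    case False
    \<comment> \<open>Two-valuedness of \<open>\<chi>\<close> matters here: outside the reachable
      set the implication holds trivially.\<close>
    then have "w \<chi> = 0"
      using \<chi>[OF w] by (simp del: rel.simps)
    then show ?thesis
      using canonical_nonneg[OF n inf w, of "Box \<alpha> \<chi>"] by (simp add: canonical_Imp[OF n inf w])
  qed
  have "u (Box (Star \<alpha>) (Pow (Imp \<chi> (Box \<alpha> \<chi>)) n)) = 1"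
    unfolding canonical_box_eq_one_iff[OF n inf u]
  proof (intro allI impI)
    fix w assume "(u, w) \<in> canonical_rel n (Star \<alpha>)"
    then have w: "w \<in> canonical n" by (rule canonical_relD(2))
    show "w (Pow (Imp \<chi> (Box \<alpha> \<chi>)) n) = 1"
      using luk_hom_Pow_n[OF canonical_luk_hom[OF n inf w] n, of "Imp \<chi> (Box \<alpha> \<chi>)"] invariant[OF w]
      by simp
  qed
  \<comment> \<open>The path of length 0 reaches the collapse of \<open>u\<close>.\<close>
  moreover have "u \<chi> = 1"
    using \<chi>[OF u] u by (simp add: worlds_model)
  ultimately have "u (Box (Star \<alpha>) \<chi>) = 1"
    using canonical_Star_induct[OF n inf u] by blast
  then have "v \<chi> = 1"
    by (rule canonical_relD(3)[OF uv])
  then show "(collapse u, collapse v) \<in> rel model (Star \<alpha>)"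
    using \<chi>[OF v] by (simp split: if_splits)
qed

lemma includes_canonical_Test:
  assumes val: "\<And>u. u \<in> canonical n \<Longrightarrow> val model \<chi> (collapse u) = u \<chi>"
  shows "includes_canonical (Test \<chi>)"
proof (rule includes_canonicalI)
  fix u \<psi>
  assume u: "u \<in> canonical n"
    and *: "\<And>v. v \<in> canonical n \<Longrightarrow> (collapse u, collapse v) \<in> rel model (Test \<chi>) \<Longrightarrow> v \<psi> = 1"
  have "u \<psi> = 1" if "u \<chi> = 1"
    using *[OF u] that u val[OF u] by (simp add: worlds_model)
  then show "u (Box (Test \<chi>) \<psi>) = 1"
    by (simp add: canonical_Test[OF n inf u])
qed

section \<open>Boxes are respected, by cases on the program\<close>

lemma respects_boxes_Atom: "respects_boxes (Atom a)"
  unfolding respects_boxes_def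
proof (intro allI impI)
  fix \<phi> u v
  assume C: "Box (Atom a) \<phi> \<in> C" and uv: "u \<in> canonical n" "v \<in> canonical n"
    and "(collapse u, collapse v) \<in> rel model (Atom a)"
  then obtain u' v' where u'v': "(u', v') \<in> canonical_rel n (Atom a)"
    "collapse u' = collapse u" "collapse v' = collapse v"
    by (auto simp: acc_model)
  \<comment> \<open>The canonical step may start and end at other representatives; both formulas lie
    in \<open>C\<close>, so the values agree.\<close>
  have "\<phi> \<in> C" using closed[OF C] by simp
  then have "u' (Box (Atom a) \<phi>) = u (Box (Atom a) \<phi>)" "v' \<phi> = v \<phi>"
    using collapse_eq_iff canonical_relD(1,2)[OF u'v'(1)] u'v' uv C by blast+
  then show "u (Box (Atom a) \<phi>) \<le> v \<phi>"
    using canonical_box_le[OF n inf u'v'(1), of \<phi>] by simp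
qed

lemma respects_boxes_Test:
  assumes "\<And>u. u \<in> canonical n \<Longrightarrow> val model \<chi> (collapse u) = u \<chi>"
  shows "respects_boxes (Test \<chi>)"
  unfolding respects_boxes_def
proof (intro allI impI)
  fix \<phi> u v
  assume C: "Box (Test \<chi>) \<phi> \<in> C" and uv: "u \<in> canonical n" "v \<in> canonical n"
    and rel: "(collapse u, collapse v) \<in> rel model (Test \<chi>)"
  have "\<phi> \<in> C" using closed[OF C] by simp
  then have "u \<phi> = v \<phi>" "u \<chi> = 1"
    using rel assms[OF uv(1)] collapse_eq_iff uv by auto
  then show "u (Box (Test \<chi>) \<phi>) \<le> v \<phi>"
    by (simp add: canonical_Test[OF n inf uv(1)])
qed

lemma respects_boxes_Seq:
  assumes "respects_boxes \<alpha>" "respects_boxes \<beta>"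
  shows "respects_boxes (Seq \<alpha> \<beta>)"
  unfolding respects_boxes_def
proof (intro allI impI)
  fix \<phi> u v
  assume C: "Box (Seq \<alpha> \<beta>) \<phi> \<in> C" and uv: "u \<in> canonical n" "v \<in> canonical n"
    and rel: "(collapse u, collapse v) \<in> rel model (Seq \<alpha> \<beta>)"
  then obtain w where w: "w \<in> canonical n" "(collapse u, collapse w) \<in> rel model \<alpha>"
    "(collapse w, collapse v) \<in> rel model \<beta>"
    using rel_model_subset[of \<alpha>] by auto
  have "u (Box \<alpha> (Box \<beta> \<phi>)) \<le> w (Box \<beta> \<phi>)" "w (Box \<beta> \<phi>) \<le> v \<phi>"
    using assms closed[OF C] uv w unfolding respects_boxes_def by simp_all
  then show "u (Box (Seq \<alpha> \<beta>) \<phi>) \<le> v \<phi>"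
    by (simp add: canonical_Seq[OF n inf uv(1)])
qed

lemma respects_boxes_Choice:
  assumes "respects_boxes \<alpha>" "respects_boxes \<beta>"
  shows "respects_boxes (Choice \<alpha> \<beta>)"
  unfolding respects_boxes_def
proof (intro allI impI)
  fix \<phi> u v
  assume C: "Box (Choice \<alpha> \<beta>) \<phi> \<in> C" and uv: "u \<in> canonical n" "v \<in> canonical n"
    and rel: "(collapse u, collapse v) \<in> rel model (Choice \<alpha> \<beta>)"
  then have "u (Box \<alpha> \<phi>) \<le> v \<phi> \<or> u (Box \<beta> \<phi>) \<le> v \<phi>"
    using assms closed[OF C] unfolding respects_boxes_def by auto
  then show "u (Box (Choice \<alpha> \<beta>) \<phi>) \<le> v \<phi>"
    by (auto simp: canonical_Choice[OF n inf uv(1)])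
qed

text \<open>The value of the starred box never drops along an \<open>\<alpha>\<close>-step:
  unfolding bounds it by \<open>Box \<alpha>\<close> of itself, which is again in
  \<open>C\<close>.\<close>

lemma respects_boxes_Star:
  assumes "respects_boxes \<alpha>"
  shows "respects_boxes (Star \<alpha>)"
  unfolding respects_boxes_def
proof (intro allI impI)
  fix \<phi> u v
  assume C: "Box (Star \<alpha>) \<phi> \<in> C" and uv: "u \<in> canonical n" "v \<in> canonical n"
    and rel: "(collapse u, collapse v) \<in> rel model (Star \<alpha>)"
  let ?\<psi> = "Box (Star \<alpha>) \<phi>"
  \<comment> \<open>All representatives of the endpoint are covered, because consecutive steps may
    meet at different ones.\<close>
  have reachable: "\<forall>w\<in>canonical n. collapse w = y \<longrightarrow> u ?\<psi> \<le> w ?\<psi>"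
    if "(collapse u, y) \<in> (rel model \<alpha>)\<^sup>*" for y
    using that
  proof induction
    case base
    show ?case using collapse_eq_iff uv(1) C by (metis order_refl)
  next
    case (step y z)
    show ?case
    proof (intro ballI impI)
      fix w assume w: "w \<in> canonical n" "collapse w = z"
      obtain w' where w': "w' \<in> canonical n" "collapse w' = y"
        using step.hyps(2) rel_model_subset[of \<alpha>] by auto
      have "u ?\<psi> \<le> w' ?\<psi>" using step.IH w' by blast
      also have "\<dots> \<le> w' (Box \<alpha> ?\<psi>)"
        by (subst canonical_Star_unfold[OF n inf w'(1)]) simp
      also have "\<dots> \<le> w ?\<psi>"
        using assms closed[OF C] w w' step.hyps(2) unfolding respects_boxes_def by auto
      finally show "u ?\<psi> \<le> w ?\<psi>" .
    qed
  qed
  have "u ?\<psi> \<le> v ?\<psi>"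
    using bspec[OF reachable uv(2), of "collapse v"] rel by simp
  also have "\<dots> \<le> v \<phi>"
    by (subst canonical_Star_unfold[OF n inf uv(2)]) simp
  finally show "u ?\<psi> \<le> v \<phi>" .
qed

text \<open>\<open>respects_boxes\<close> gives the lower bound, and
  \<open>includes_canonical\<close> carries a canonical successor attaining the minimum into the
  model.\<close>

lemma truth_Box:
  assumes "includes_canonical \<alpha>" "respects_boxes \<alpha>" "Box \<alpha> \<phi> \<in> C" "u \<in> canonical n"
    and val: "\<And>u. u \<in> canonical n \<Longrightarrow> val model \<phi> (collapse u) = u \<phi>"
  shows "val model (Box \<alpha> \<phi>) (collapse u) = u (Box \<alpha> \<phi>)"
proof (rule val_Box_eqI)
  fix x assume x: "(collapse u, x) \<in> rel model \<alpha>"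
  then obtain v where v: "v \<in> canonical n" "x = collapse v"
    using rel_model_subset by blast
  then show "u (Box \<alpha> \<phi>) \<le> val model \<phi> x"
    using assms x unfolding respects_boxes_def by auto
  show "val model \<phi> x \<le> 1"
    using v val canonical_le_one[OF n inf] by simp
next
  assume "u (Box \<alpha> \<phi>) \<noteq> 1"
  then obtain v where "(u, v) \<in> canonical_rel n \<alpha>" "v \<phi> = u (Box \<alpha> \<phi>)"
    using canonical_box_attained[OF n inf assms(4)] by blast
  then show "\<exists>x. (collapse u, x) \<in> rel model \<alpha> \<and> val model \<phi> x = u (Box \<alpha> \<phi>)"
    using assms(1) val canonical_relD(2) unfolding includes_canonical_def by metis
qed

text \<open>Tests force a simultaneous induction on programs. A subprogram is boxed before another
  formula, such as \<open>Box (Star \<alpha>) \<psi>\<close>, whence the arbitrary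
  \<open>\<psi>\<close>; closure keeps these boxes in \<open>C\<close>.\<close>

lemma truth:
  shows "\<phi> \<in> C \<Longrightarrow> u \<in> canonical n \<Longrightarrow> val model \<phi> (collapse u) = u \<phi>"
    and "Box \<alpha> \<psi> \<in> C \<Longrightarrow> includes_canonical \<alpha> \<and> respects_boxes \<alpha>"
proof (induction \<phi> and \<alpha> arbitrary: u and \<psi>)
  case (Var p)
  then show ?case by (simp add: valu_model)
next
  case Zero
  then show ?case using luk_hom_Zero[OF canonical_luk_hom[OF n inf]] by simp
next
  case (Neg \<phi>)
  then show ?case
    using closed[OF Neg.prems(1)] luk_hom_Neg[OF canonical_luk_hom[OF n inf Neg.prems(2)]]
    by (simp add: luk_neg_def)
next
  case (Imp \<phi> \<psi>)
  then show ?case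
    using closed[OF Imp.prems(1)] canonical_Imp[OF n inf Imp.prems(2)] by (simp add: luk_imp_def)
next
  case (Box \<alpha> \<phi>)
  then have "\<phi> \<in> C"
    using closed[OF Box.prems(1)] by (cases \<alpha>) auto
  with Box show ?case using truth_Box by blast
next
  case (Atom a)
  then show ?case
    using respects_boxes_Atom by (auto simp: includes_canonical_def acc_model)
next
  case (Test \<chi>)
  then show ?case
    using closed[OF Test.prems] includes_canonical_Test respects_boxes_Test by simp
next
  case (Seq \<alpha> \<beta>)
  then have "includes_canonical \<alpha> \<and> respects_boxes \<alpha>" "includes_canonical \<beta> \<and> respects_boxes \<beta>"
    using closed[OF Seq.prems] by auto
  then show ?case using includes_canonical_Seq respects_boxes_Seq by blast
next
  case (Choice \<alpha> \<beta>)
  then have "includes_canonical \<alpha> \<and> respects_boxes \<alpha>" "includes_canonical \<beta> \<and> respects_boxes \<beta>"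
    using closed[OF Choice.prems] by auto
  then show ?case using includes_canonical_Choice respects_boxes_Choice by blast
next
  case (Star \<alpha>)
  then have "includes_canonical \<alpha> \<and> respects_boxes \<alpha>"
    using closed[OF Star.prems] by auto
  then show ?case using includes_canonical_Star respects_boxes_Star by blast
qed

end

section \<open>Completeness, by collapsing along the closure of an unprovable formula\<close>

theorem theorem5p13:
  fixes n :: nat and \<phi> :: "('a, 'p::countable) form"
  assumes "n \<ge> 1"
    and "infinite (UNIV :: 'p set)"
    and "infinite (UNIV :: 'w set)"
    and "\<And>(M :: ('w, 'a, 'p) kripke) w.
           kripke_model n M \<Longrightarrow> w \<in> worlds M \<Longrightarrow> true_at M w \<phi>"
  shows "\<phi> \<in> PDL n"
proof (rule ccontr)
  assume not_provable: "\<phi> \<notin> PDL n"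
  obtain u :: "('a, 'p) form \<Rightarrow> real" where u: "u \<in> canonical n" "u \<phi> \<noteq> 1"
  proof (rule separating_world[OF assms(1,2) order_refl _ not_provable])
    show "\<chi> \<in> PDL n" if "\<psi> \<in> PDL n" "Imp \<psi> \<chi> \<in> PDL n" for \<psi> \<chi> :: "('a, 'p) form"
      using that by (rule PDL.mp)
  qed blast
  have "finite (PiE (FL \<phi>) (\<lambda>_. luk_set n))"
    using finite_FL(1) finite_luk_set by (intro finite_PiE) auto
  \<comment> \<open>An infinite type has a subset of every finite cardinality, so the finitely many
    tables of values can be coded in \<open>'w\<close>.\<close>
  then obtain g :: "(('a, 'p) form \<Rightarrow> real) \<Rightarrow> 'w" where "inj_on g (PiE (FL \<phi>) (\<lambda>_. luk_set n))"
    using infinite_arbitrarily_large[OF assms(3)] inj_on_iff_card_le by (metis order_refl)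
  then interpret filtration n "FL \<phi>" g
    using assms(1,2) finite_FL(1) FL_closed(1) by unfold_locales
  have "val model \<phi> (collapse u) = u \<phi>"
    using truth(1) FL_refl(1) u(1) by blast
  moreover have "val model \<phi> (collapse u) = 1"
    using assms(4)[OF kripke_model_model[OF u(1)], of "collapse u"] u(1)
    by (simp add: true_at_def worlds_model)
  ultimately show False using u(2) by simp
qed

end
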